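(* Suppose that (i) $\Pi_{N,E}\Rightarrow\Pi_E$ weakly as $N\to\infty$ for some probability measure $\Pi_E$ on $\Delta(\mathcal X)$; (ii) the projection map $T_E$ is (defined and) continuous on a neighborhood of $\operatorname{supp}(\Pi_E)$ in $\Delta(\mathcal X)$; (iii) for every fixed $m$, $$\int\big\|\mathbb Q_{N,\mu}(X_{1:m}\in\cdot)-T_E(\mu)^{\otimes m}\big\|_{\mathrm{TV}}\,\Pi_{N,E}(d\mu)\longrightarrow 0\qquad (N\to\infty).$$ Then for every fixed $m$ and every sequence of $m$-element sets $I_N\subseteq\{1,\dots,N\}$, $$\mathbb Q_N(X_{I_N}\in\cdot)\longrightarrow\int T_E(\mu)^{\otimes m}\,\Pi_E(d\mu)$$ in total variation. Consequently, with $\widetilde\Pi_E=(T_E)_\#\Pi_E$ (the pushforward of $\Pi_E$ under $T_E$), the family $\widetilde{\mathbb P}^{(m)}_E=\int q^{\otimes m}\,\widetilde\Pi_E(dq)$, $m\ge1$, is projectively consistent and defines an infinite exchangeable law $\widetilde{\mathbb P}_E=\int q^{\otimes\infty}\,\widetilde\Pi_E(dq)$ on $\mathcal X^{\mathbb N}$, whose random directing measure is $Q^\star=T_E(\mu)$ with $\mu\sim\Pi_E$ (so $Q^\star\sim\widetilde\Pi_E$).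
   Context: Let $\mathcal X=\{1,\dots,k\}$, $\Delta(\mathcal X)$ the probability simplex, $\|P-Q\|_{\mathrm{TV}}=\tfrac12\sum|P-Q|$, $D(Q\|\mu)=\sum_xQ(x)\log\{Q(x)/\mu(x)\}$ ($=+\infty$ if $Q\not\ll\mu$), $\langle g,Q\rangle=\sum_xg(x)Q(x)$. Given $g_1,\dots,g_r:\mathcal X\to\mathbb R$, $\alpha_j\in\mathbb R$, $0\le r_0\le r$, let $$E=\{Q\in\Delta(\mathcal X):\langle g_j,Q\rangle=\alpha_j\ (j\le r_0),\ \langle g_j,Q\rangle\ge\alpha_j\ (r_0<j\le r)\}\ne\varnothing,$$ $$E_\varepsilon=\{Q\in\Delta(\mathcal X):|\langle g_j,Q\rangle-\alpha_j|\le\varepsilon\ (j\le r_0),\ \langle g_j,Q\rangle\ge\alpha_j-\varepsilon\ (r_0<j\le r)\},$$ and let $\varepsilon_N>0$, $\varepsilon_N\to0$. Let $\Pi$ (the prior) be a probability measure on $\Delta(\mathcal X)$. Under $\mathbb P_\mu$, $X_1,\dots,X_N$ are i.i.d. $\mu$; $\widehat P_N=\frac1N\sum_{i\le N}\delta_{X_i}$ and $E_N=\{\widehat P_N\in E_{\varepsilon_N}\}$. It is assumed that $\int\mathbb P_\nu(E_N)\Pi(d\nu)>0$ for the $N$ considered. Define the constraint posterior $$\Pi_{N,E}(d\mu)=\frac{\mathbb P_\mu(E_N)\,\Pi(d\mu)}{\int\mathbb P_\nu(E_N)\,\Pi(d\nu)},$$ the constrained component law $\mathbb Q_{N,\mu}(\cdot)=\mathbb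 P_\mu(\cdot\mid E_N)$ (defined for $\Pi_{N,E}$-a.e. $\mu$), and the constrained-horizon law $\mathbb Q_N(d\mu,dx_{1:N})=\Pi_{N,E}(d\mu)\,\mathbb Q_{N,\mu}(dx_{1:N})$. The projection map is $T_E(\mu)=P^\star_\mu=\arg\min_{Q\in E}D(Q\|\mu)$, defined (the minimizer being unique) at every $\mu$ for which the minimum is finite, in particular at every strictly positive $\mu$; it is assumed that $T_E(\mu)$ is defined for $\Pi_{N,E}$-a.e. $\mu$. A random measure $Q^\star$ directs an exchangeable sequence if, conditionally on $Q^\star$, the sequence is i.i.d. $Q^\star$. *)

theory Defs
  imports "HOL-Probability.Probability" "HOL-Combinatorics.Permutations"
begin

section \<open>The probability simplex over a finite alphabet\<close>

text \<open>The alphabet is the universe of a finite type \<^typ>\<open>'a\<close>, so that the number of letters is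
  the cardinality of that type.  A probability vector is a point of \<^typ>\<open>real^'a\<close>; the simplex
  carries the subspace topology and the corresponding Borel sigma-algebra.\<close>

definition prob_simplex :: "(real^'a::finite) set" where
  "prob_simplex = {q. (\<forall>x. 0 \<le> q $ x) \<and> (\<Sum>x\<in>UNIV. q $ x) = 1}"

definition simplex_borel :: "(real^'a::finite) measure" where
  "simplex_borel = restrict_space borel prob_simplex"

text \<open>Used for points of \<^const>\<open>prob_simplex\<close> only (arbitrary elsewhere).\<close>

definition simplex_pmf :: "real^'a::finite \<Rightarrow> 'a pmf" where
  "simplex_pmf q = embed_pmf (\<lambda>x. q $ x)"

definition pairing :: "('a::finite \<Rightarrow> real) \<Rightarrow> real^'a \<Rightarrow> real" where
  "pairing g q = (\<Sum>x\<in>UNIV. g x * q $ x)"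

text \<open>Relative entropy with natural logarithm.  The summands with \<open>q $ x = 0\<close> vanish, and the value
  is infinite unless \<open>q\<close> is absolutely continuous with respect to \<open>\<mu>\<close>.\<close>

definition rel_entropy :: "real^'a::finite \<Rightarrow> real^'a \<Rightarrow> ereal" where
  "rel_entropy q \<mu> =
     (if \<forall>x. \<mu> $ x = 0 \<longrightarrow> q $ x = 0
      then ereal (\<Sum>x\<in>UNIV. q $ x * ln (q $ x / \<mu> $ x)) else \<infinity>)"

section \<open>Constraint sets and the projection map\<close>

definition constraint_set ::
    "(nat \<Rightarrow> 'a::finite \<Rightarrow> real) \<Rightarrow> (nat \<Rightarrow> real) \<Rightarrow> nat \<Rightarrow> nat \<Rightarrow> (real^'a) set" where
  "constraint_set g \<alpha> r0 r =
     {q \<in> prob_simplex. (\<forall>j\<in>{1..r0}. pairing (g j) q = \<alpha> j) \<and>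
                        (\<forall>j\<in>{r0<..r}. pairing (g j) q \<ge> \<alpha> j)}"

definition relaxed_constraint_set ::
    "(nat \<Rightarrow> 'a::finite \<Rightarrow> real) \<Rightarrow> (nat \<Rightarrow> real) \<Rightarrow> nat \<Rightarrow> nat \<Rightarrow> real \<Rightarrow> (real^'a) set" where
  "relaxed_constraint_set g \<alpha> r0 r \<epsilon> =
     {q \<in> prob_simplex. (\<forall>j\<in>{1..r0}. \<bar>pairing (g j) q - \<alpha> j\<bar> \<le> \<epsilon>) \<and>
                        (\<forall>j\<in>{r0<..r}. pairing (g j) q \<ge> \<alpha> j - \<epsilon>)}"

definition proj_map :: "(real^'a::finite) set \<Rightarrow> real^'a \<Rightarrow> real^'a" where
  "proj_map E \<mu> = arg_min (\<lambda>q. rel_entropy q \<mu>) (\<lambda>q. q \<in> E)"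

text \<open>The points at which the projection is defined: those where the minimum over \<open>E\<close> is finite.
  Elsewhere in the simplex every point of \<open>E\<close> is a minimizer, and \<^const>\<open>proj_map\<close> takes one and the same
  arbitrary value in \<open>E\<close> (if \<open>E\<close> is nonempty).\<close>

definition proj_dom :: "(real^'a::finite) set \<Rightarrow> (real^'a) set" where
  "proj_dom E = {\<mu> \<in> prob_simplex.
     \<exists>q. is_arg_min (\<lambda>q. rel_entropy q \<mu>) (\<lambda>q. q \<in> E) q \<and> rel_entropy q \<mu> < \<infinity>}"

section \<open>Sequences\<close>

text \<open>Coordinates are numbered from 1.  A finite horizon \<open>N\<close> is the index set \<open>{1..N}\<close>, and infinite
  sequences have index set \<open>{1..}\<close>.\<close>

definition seq_space :: "nat set \<Rightarrow> (nat \<Rightarrow> 'a::finite) measure" where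
  "seq_space J = (\<Pi>\<^sub>M i\<in>J. count_space UNIV)"

definition iid_law :: "nat set \<Rightarrow> real^'a::finite \<Rightarrow> (nat \<Rightarrow> 'a) measure" where
  "iid_law J q = (\<Pi>\<^sub>M i\<in>J. measure_pmf (simplex_pmf q))"

definition empirical :: "nat \<Rightarrow> (nat \<Rightarrow> 'a::finite) \<Rightarrow> real^'a" where
  "empirical N x = (\<chi> a. real (card {i\<in>{1..N}. x i = a}) / real N)"

text \<open>The block of coordinates in a finite index set \<open>I\<close>, listed in increasing order of index.\<close>

definition block :: "nat set \<Rightarrow> (nat \<Rightarrow> 'a) \<Rightarrow> nat \<Rightarrow> 'a" where
  "block I x = (\<lambda>j\<in>{1..card I}. x (sorted_list_of_set I ! (j - 1)))"

text \<open>Total variation distance of two measures on the same finite discrete space.\<close>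

definition tv_dist :: "'b measure \<Rightarrow> 'b measure \<Rightarrow> real" where
  "tv_dist P Q = (1/2) * (\<Sum>y\<in>space P. \<bar>measure P {y} - measure Q {y}\<bar>)"

section \<open>Constraint posterior and constrained laws\<close>

text \<open>In this section \<open>A\<close> is the set that the empirical measure is required to lie in.\<close>

definition empirical_event :: "(real^'a::finite) set \<Rightarrow> nat \<Rightarrow> (nat \<Rightarrow> 'a) set" where
  "empirical_event A N = {x \<in> space (seq_space {1..N}). empirical N x \<in> A}"

definition event_mass :: "(real^'a::finite) measure \<Rightarrow> (real^'a) set \<Rightarrow> nat \<Rightarrow> ennreal" where
  "event_mass \<rho> A N = (\<integral>\<^sup>+\<nu>. emeasure (iid_law {1..N} \<nu>) (empirical_event A N) \<partial>\<rho>)"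

definition constraint_posterior ::
    "(real^'a::finite) measure \<Rightarrow> (real^'a) set \<Rightarrow> nat \<Rightarrow> (real^'a) measure" where
  "constraint_posterior \<rho> A N =
     density \<rho> (\<lambda>\<mu>. emeasure (iid_law {1..N} \<mu>) (empirical_event A N) / event_mass \<rho> A N)"

text \<open>The conditional law given the event; it is the null measure for those \<open>\<mu>\<close> that give the event
  probability zero, and these form a null set of the constraint posterior.\<close>

definition constrained_component ::
    "(real^'a::finite) set \<Rightarrow> nat \<Rightarrow> real^'a \<Rightarrow> (nat \<Rightarrow> 'a) measure" where
  "constrained_component A N \<mu> = uniform_measure (iid_law {1..N} \<mu>) (empirical_event A N)"

text \<open>The law \<open>\<rho>(d\<mu>) K(\<mu>, dx)\<close> of a random parameter and a random sequence.\<close>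

definition joint_law ::
    "nat set \<Rightarrow> (real^'a::finite) measure \<Rightarrow> (real^'a \<Rightarrow> (nat \<Rightarrow> 'a) measure)
      \<Rightarrow> ((real^'a) \<times> (nat \<Rightarrow> 'a)) measure" where
  "joint_law J \<rho> K =
     \<rho> \<bind> (\<lambda>\<mu>. K \<mu> \<bind> (\<lambda>x. return (simplex_borel \<Otimes>\<^sub>M seq_space J) (\<mu>, x)))"

definition constrained_horizon_law ::
    "(real^'a::finite) measure \<Rightarrow> (real^'a) set \<Rightarrow> nat \<Rightarrow> ((real^'a) \<times> (nat \<Rightarrow> 'a)) measure" where
  "constrained_horizon_law \<rho> A N =
     joint_law {1..N} (constraint_posterior \<rho> A N) (constrained_component A N)"

section \<open>Weak convergence and support on the simplex\<close>

definition simplex_weak_conv ::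
    "('i \<Rightarrow> (real^'a::finite) measure) \<Rightarrow> (real^'a) measure \<Rightarrow> 'i filter \<Rightarrow> bool" where
  "simplex_weak_conv R \<rho> F \<longleftrightarrow>
     (\<forall>f :: real^'a \<Rightarrow> real. continuous_on prob_simplex f \<longrightarrow> bounded (f ` prob_simplex) \<longrightarrow>
        ((\<lambda>i. \<integral>q. f q \<partial>R i) \<longlongrightarrow> (\<integral>q. f q \<partial>\<rho>)) F)"

definition measure_support :: "'b::topological_space measure \<Rightarrow> 'b set" where
  "measure_support \<rho> =
     {x \<in> space \<rho>. \<forall>U. open U \<longrightarrow> x \<in> U \<longrightarrow> emeasure \<rho> (U \<inter> space \<rho>) > 0}"

section \<open>Mixtures of i.i.d. laws and directing measures\<close>

definition iid_mixture :: "nat set \<Rightarrow> (real^'a::finite) measure \<Rightarrow> (nat \<Rightarrow> 'a) measure" where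
  "iid_mixture J \<rho> = \<rho> \<bind> iid_law J"

definition projectively_consistent :: "(nat \<Rightarrow> (nat \<Rightarrow> 'a::finite) measure) \<Rightarrow> bool" where
  "projectively_consistent P \<longleftrightarrow>
     (\<forall>m\<ge>1. prob_space (P m) \<and> sets (P m) = sets (seq_space {1..m})) \<and>
     (\<forall>m n. 1 \<le> m \<longrightarrow> m \<le> n \<longrightarrow>
        distr (P n) (seq_space {1..m}) (\<lambda>x. restrict x {1..m}) = P m)"

definition sequence_law_with_marginals ::
    "(nat \<Rightarrow> (nat \<Rightarrow> 'a::finite) measure) \<Rightarrow> (nat \<Rightarrow> 'a) measure \<Rightarrow> bool" where
  "sequence_law_with_marginals P L \<longleftrightarrow>
     prob_space L \<and> sets L = sets (seq_space {1..}) \<and>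
     (\<forall>m\<ge>1. distr L (seq_space {1..m}) (\<lambda>x. restrict x {1..m}) = P m)"

definition exchangeable_law :: "(nat \<Rightarrow> 'a::finite) measure \<Rightarrow> bool" where
  "exchangeable_law L \<longleftrightarrow>
     prob_space L \<and> sets L = sets (seq_space {1..}) \<and>
     (\<forall>n \<pi>. \<pi> permutes {1..n} \<longrightarrow>
        distr L (seq_space {1..}) (\<lambda>x. \<lambda>i\<in>{1..}. x (\<pi> i)) = L)"

text \<open>On the probability space \<open>M\<close>, the random measure \<open>Q\<close> directs the random sequence \<open>X\<close>: the
  conditional law of \<open>X\<close> given the sigma-algebra generated by \<open>Q\<close> is the i.i.d. law with common
  distribution \<open>Q\<close>.\<close>

definition directs ::
    "'w measure \<Rightarrow> ('w \<Rightarrow> real^'a::finite) \<Rightarrow> ('w \<Rightarrow> nat \<Rightarrow> 'a) \<Rightarrow> bool" where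
  "directs M Q X \<longleftrightarrow>
     Q \<in> M \<rightarrow>\<^sub>M simplex_borel \<and> X \<in> M \<rightarrow>\<^sub>M seq_space {1..} \<and>
     (\<forall>B\<in>sets (seq_space {1..}).
        AE w in M. real_cond_exp M (vimage_algebra (space M) Q simplex_borel)
                     (indicator (X -` B \<inter> space M)) w
                   = measure (iid_law {1..} (Q w)) B)"

end

theory Submission
  imports Defs "HOL-Real_Asymp.Real_Asymp"
begin

text \<open>The constrained component laws are exchangeable, so the block \<open>I\<^sub>N\<close> may be replaced by the
  initial block, and the third hypothesis replaces its law by the power \<open>T\<^sub>E(\<mu>)\<^sup>m\<close> under the
  constraint posterior.  The point masses of \<open>T\<^sub>E(\<mu>)\<^sup>m\<close> are continuous near the support of the limit;
  multiplied by a Urysohn function of the support they become globally continuous, with an error that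
  vanishes in the weak limit.  The mixtures make sense because \<open>T\<^sub>E\<close> is Borel on the whole simplex: on
  each of the finitely many classes of vectors with a given set of nonzero coordinates it is constant,
  or the unique minimizer over a compact set of a jointly continuous function that is strictly convex
  in the variable to be minimized, hence continuous.\<close>

section \<open>The entropy projection is Borel\<close>

text \<open>The projection is assumed continuous only near the support of the limit, but the kernels
  built from \<open>proj_map E\<close> are integrated over the whole simplex, so measurability is
  required everywhere. The obstacle is the entropy: when \<open>q $ x\<close> and
  \<open>\<mu> $ x\<close> tend to 0 together, the summand
  \<open>q $ x * ln (q $ x / \<mu> $ x)\<close> has no limit, and where \<open>\<mu> $ x = 0\<close>
  the value jumps to infinity. Fixing the zero set of \<open>\<mu>\<close> removes both effects.
  Finiteness of the alphabet reduces total variation on a block to finitely many point masses; these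
  lie between 0 and 1, which is the bound used in the weak limit.\<close>

lemma continuous_on_x_ln_x: "continuous_on {0..} (\<lambda>x::real. x * ln x)"
proof (rule continuous_on_eq_continuous_within[THEN iffD2, rule_format])
  fix x :: real assume "x \<in> {0..}"
  show "continuous (at x within {0..}) (\<lambda>x. x * ln x)"
  proof (cases "x = 0")
    case True
    have "((\<lambda>x::real. x * ln x) \<longlongrightarrow> 0) (at_right 0)" by real_asymp
    moreover have "at (0::real) within {0..} = at_right 0"
      by (rule at_within_nhd[where S=UNIV]) auto
    ultimately show ?thesis using True by (simp add: continuous_within)
  next
    case False
    then show ?thesis using \<open>x \<in> {0..}\<close> by (intro continuous_intros) auto
  qed
qed

text \<open>Strict convexity by tangents: \<open>t * ln (m / c) + (t - m)\<close> is the tangent of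
  \<open>t * ln (t / c)\<close> at the midpoint \<open>m\<close>. Adding the strict inequalities at
  \<open>a\<close> and \<open>b\<close> cancels the linear terms, as \<open>a + b = 2 * m\<close>.
  One of \<open>a\<close>, \<open>b\<close> may be 0, where the function has the value 0; points of
  a face can have such coordinates.\<close>

lemma x_ln_x_midpoint_less:
  fixes a b c :: real
  assumes "0 \<le> a" "0 \<le> b" "a \<noteq> b" "0 < c"
  shows "2 * ((a + b) / 2 * ln ((a + b) / 2 / c)) < a * ln (a / c) + b * ln (b / c)"
proof -
  define m where "m = (a + b) / 2"
  have m: "0 < m" using assms unfolding m_def by (cases "a = 0") auto
  have tangent: "t * ln (m / c) + (t - m) < t * ln (t / c)" if "0 \<le> t" "t \<noteq> m" for t
  proof (cases "t = 0")
    case False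
    then have t: "0 < t" using that by simp
    have "ln (m / t) < m / t - 1"
      using ln_le_minus_one[of "m / t"] ln_eq_minus_one[of "m / t"] t m that(2) by fastforce
    then have "t * ln (m / t) < t * (m / t - 1)" using t by simp
    also have "\<dots> = m - t" using t by (simp add: field_simps)
    finally show ?thesis using t m \<open>0 < c\<close> by (simp add: ln_div algebra_simps)
  qed (use m in simp)
  have "a \<noteq> m" "b \<noteq> m" using assms unfolding m_def by auto
  then have "a * ln (m / c) + (a - m) + (b * ln (m / c) + (b - m)) < a * ln (a / c) + b * ln (b / c)"
    using tangent[of a] tangent[of b] assms by linarith
  moreover have "a * ln (m / c) + (a - m) + (b * ln (m / c) + (b - m)) = 2 * (m * ln (m / c))"
    unfolding m_def by (simp add: field_simps)
  ultimately show ?thesis unfolding m_def by simp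
qed

section \<open>Compactness and midpoint stability of the constraint sets\<close>

lemma closed_prob_simplex: "closed (prob_simplex :: (real^'a::finite) set)"
proof -
  have "prob_simplex = (\<Inter>x. {q :: real^'a. 0 \<le> q $ x}) \<inter> {q. (\<Sum>x\<in>UNIV. q $ x) = 1}"
    by (auto simp: prob_simplex_def)
  moreover have "closed (\<Inter>x. {q :: real^'a. 0 \<le> q $ x})"
    by (intro closed_INT ballI closed_Collect_le continuous_intros)
  moreover have "closed {q :: real^'a. (\<Sum>x\<in>UNIV. q $ x) = 1}"
    by (intro closed_Collect_eq continuous_intros)
  ultimately show ?thesis by (metis closed_Int)
qed

lemma prob_simplex_le_1: "q \<in> prob_simplex \<Longrightarrow> q $ x \<le> 1"
  using member_le_sum[of x UNIV "\<lambda>x. q $ x"] by (auto simp: prob_simplex_def)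

lemma compact_prob_simplex: "compact (prob_simplex :: (real^'a::finite) set)"
proof -
  have "norm q \<le> real CARD('a)" if "q \<in> prob_simplex" for q :: "real^'a"
  proof -
    have "norm q \<le> (\<Sum>x\<in>UNIV. \<bar>q $ x\<bar>)" by (rule norm_le_l1_cart)
    also have "\<dots> \<le> (\<Sum>x\<in>(UNIV::'a set). 1)"
      using that prob_simplex_le_1[OF that] by (intro sum_mono) (auto simp: prob_simplex_def)
    finally show ?thesis by simp
  qed
  then show ?thesis
    using closed_prob_simplex by (auto simp: compact_eq_bounded_closed bounded_iff)
qed

lemma constraint_set_subset: "constraint_set g \<alpha> r0 r \<subseteq> prob_simplex"
  by (auto simp: constraint_set_def)

lemma closed_constraint_set: "closed (constraint_set g \<alpha> r0 r :: (real^'a::finite) set)"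
proof -
  have "constraint_set g \<alpha> r0 r = prob_simplex \<inter> (\<Inter>j\<in>{1..r0}. {q::real^'a. pairing (g j) q = \<alpha> j})
      \<inter> (\<Inter>j\<in>{r0<..r}. {q. \<alpha> j \<le> pairing (g j) q})"
    by (auto simp: constraint_set_def)
  then show ?thesis
    unfolding pairing_def
    by (auto intro!: closed_Int closed_INT closed_Collect_le closed_Collect_eq continuous_intros
        closed_prob_simplex)
qed

lemma pairing_midpoint: "pairing g ((1/2) *\<^sub>R (p + q)) = (pairing g p + pairing g q) / 2"
  by (simp add: pairing_def sum_distrib_left sum_divide_distrib flip: sum.distrib)
     (auto intro!: sum.cong simp: field_simps)

lemma midpoint_constraint_set:
  assumes "p \<in> constraint_set g \<alpha> r0 r" "q \<in> constraint_set g \<alpha> r0 r"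
  shows "(1/2) *\<^sub>R (p + q) \<in> constraint_set g \<alpha> r0 r"
proof -
  have "(\<Sum>x\<in>UNIV. (p $ x + q $ x) / 2) = 1"
    using assms by (simp add: constraint_set_def prob_simplex_def sum.distrib flip: sum_divide_distrib)
  then show ?thesis
    using assms by (fastforce simp: constraint_set_def prob_simplex_def pairing_midpoint)
qed

text \<open>Throughout one class the entropy is finite at the same points of \<open>E\<close>,
  whatever \<open>\<mu>\<close> is: those supported in \<open>S\<close>, collected in
  \<open>face\<close>. This makes the domain of the minimization independent of
  \<open>\<mu>\<close>.\<close>

definition support_class :: "'a::finite set \<Rightarrow> (real^'a) set" where
  "support_class S = {\<mu> \<in> prob_simplex. \<forall>x. \<mu> $ x = 0 \<longleftrightarrow> x \<notin> S}"

definition face :: "(real^'a::finite) set \<Rightarrow> 'a set \<Rightarrow> (real^'a) set" where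
  "face E S = {q \<in> E. \<forall>x. x \<notin> S \<longrightarrow> q $ x = 0}"

definition entropy_sum :: "real^'a::finite \<Rightarrow> real^'a \<Rightarrow> real" where
  "entropy_sum q \<mu> = (\<Sum>x\<in>UNIV. q $ x * ln (q $ x / \<mu> $ x))"

lemma rel_entropy_support_class:
  assumes "\<mu> \<in> support_class S" "q \<in> E"
  shows "rel_entropy q \<mu> = (if q \<in> face E S then ereal (entropy_sum q \<mu>) else \<infinity>)"
  using assms by (auto simp: rel_entropy_def support_class_def face_def entropy_sum_def)

lemma borel_support_class: "support_class S \<in> sets (borel :: (real^'a::finite) measure)"
proof -
  have "support_class S = prob_simplex \<inter> (\<Inter>x\<in>S. {\<mu>::real^'a. \<mu> $ x \<noteq> 0}) \<inter> (\<Inter>x\<in>-S. {\<mu>. \<mu> $ x = 0})"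
    by (auto simp: support_class_def)
  moreover have "closed (\<Inter>x\<in>-S. {\<mu>::real^'a. \<mu> $ x = 0})"
    by (intro closed_INT ballI closed_Collect_eq continuous_intros)
  moreover have "open (\<Inter>x\<in>S. {\<mu>::real^'a. \<mu> $ x \<noteq> 0})"
    by (intro open_INT ballI open_Collect_neq continuous_intros) auto
  ultimately show ?thesis
    using closed_prob_simplex by (metis sets.Int borel_closed borel_open)
qed

lemma compact_face:
  assumes "closed E" "E \<subseteq> prob_simplex"
  shows "compact (face E S :: (real^'a::finite) set)"
proof -
  have "face E S = prob_simplex \<inter> (E \<inter> (\<Inter>x\<in>-S. {q::real^'a. q $ x = 0}))"
    using assms(2) by (auto simp: face_def)
  then show ?thesis
    using assms(1) by (auto intro!: compact_Int_closed compact_prob_simplex closed_Int closed_INT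
        closed_Collect_eq continuous_intros)
qed

text \<open>Splitting the logarithm of the quotient leaves \<open>q * ln q\<close>, continuous up to
  0, and \<open>q * ln \<mu>\<close>, harmless because \<open>\<mu>\<close> is positive on
  \<open>S\<close>. The parameter space is arbitrary so that the result applies both in
  \<open>q\<close> alone, for existence of a minimizer, and jointly in both arguments, for the graph
  of the projection.\<close>

lemma continuous_on_entropy_sum:
  fixes f h :: "'b::topological_space \<Rightarrow> real^'a::finite"
  assumes E: "E \<subseteq> prob_simplex"
    and f: "continuous_on D f" "\<And>z. z \<in> D \<Longrightarrow> f z \<in> face E S"
    and h: "continuous_on D h" "\<And>z. z \<in> D \<Longrightarrow> h z \<in> support_class S"
  shows "continuous_on D (\<lambda>z. entropy_sum (f z) (h z))"
proof -
  have "entropy_sum (f z) (h z) = (\<Sum>x\<in>S. f z $ x * ln (f z $ x) - f z $ x * ln (h z $ x))"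
    if "z \<in> D" for z
  proof -
    have "entropy_sum (f z) (h z) = (\<Sum>x\<in>S. f z $ x * ln (f z $ x / h z $ x))"
      unfolding entropy_sum_def using f(2)[OF that]
      by (intro sum.mono_neutral_right) (auto simp: face_def)
    also have "\<dots> = (\<Sum>x\<in>S. f z $ x * ln (f z $ x) - f z $ x * ln (h z $ x))"
    proof (rule sum.cong)
      fix x assume "x \<in> S"
      have "0 < h z $ x"
        using h(2)[OF that] \<open>x \<in> S\<close> by (auto simp: support_class_def prob_simplex_def less_le)
      moreover have "0 \<le> f z $ x"
        using f(2)[OF that] E by (auto simp: face_def prob_simplex_def)
      ultimately show "f z $ x * ln (f z $ x / h z $ x) = f z $ x * ln (f z $ x) - f z $ x * ln (h z $ x)"
        by (cases "f z $ x = 0") (auto simp: ln_div algebra_simps)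
    qed simp
    finally show ?thesis .
  qed
  moreover have "continuous_on D (\<lambda>z. \<Sum>x\<in>S. f z $ x * ln (f z $ x) - f z $ x * ln (h z $ x))"
  proof (intro continuous_on_sum continuous_on_diff)
    fix x assume "x \<in> S"
    have "f z $ x \<in> {0..}" if "z \<in> D" for z
      using f(2)[OF that] E by (auto simp: face_def prob_simplex_def)
    then show "continuous_on D (\<lambda>z. f z $ x * ln (f z $ x))"
      by (intro continuous_on_compose2[OF continuous_on_x_ln_x] continuous_on_component f(1)) auto
    show "continuous_on D (\<lambda>z. f z $ x * ln (h z $ x))"
      using h(2) \<open>x \<in> S\<close>
      by (intro continuous_on_mult continuous_on_ln continuous_on_component f(1) h(1))
         (auto simp: support_class_def)
  qed
  ultimately show ?thesis
    using continuous_on_cong[OF refl] by simp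
qed

text \<open>Compactness of the face gives a minimizer and strict convexity makes it the only one.
  The form of an equivalence, with competitors restricted to the face, describes the graph of the
  projection by real inequalities; the closed graph argument rests on it.\<close>

lemma proj_map_support_class:
  fixes g :: "nat \<Rightarrow> 'a::finite \<Rightarrow> real"
  assumes E_def: "E = constraint_set g \<alpha> r0 r" and ne: "face E S \<noteq> {}"
    and \<mu>: "\<mu> \<in> support_class S"
  shows "proj_map E \<mu> = q \<longleftrightarrow> q \<in> face E S \<and> (\<forall>p\<in>face E S. entropy_sum q \<mu> \<le> entropy_sum p \<mu>)"
proof -
  let ?min = "\<lambda>q. q \<in> face E S \<and> (\<forall>p\<in>face E S. entropy_sum q \<mu> \<le> entropy_sum p \<mu>)"
  have E: "closed E" "E \<subseteq> prob_simplex"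
    unfolding E_def by (rule closed_constraint_set constraint_set_subset)+
  have ex: "\<exists>q. ?min q"
    using continuous_attains_inf[OF compact_face[OF E] ne
        continuous_on_entropy_sum[OF E(2), where f="\<lambda>q. q" and h="\<lambda>_. \<mu>"]] \<mu>
    by (auto simp: continuous_on_id)
  have unique: "p = q" if p: "?min p" and q: "?min q" for p q
  proof (rule ccontr)
    assume "p \<noteq> q"
    then obtain y where y: "p $ y \<noteq> q $ y" by (auto simp: vec_eq_iff)
    define m where "m = (1/2) *\<^sub>R (p + q)"
    have m: "m \<in> face E S"
      using p q midpoint_constraint_set[of p g \<alpha> r0 r q] by (auto simp: face_def E_def m_def)
    have nonneg: "0 \<le> p $ x" "0 \<le> q $ x" for x
      using p q E(2) by (auto simp: face_def prob_simplex_def)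
    have \<mu>_pos: "0 < \<mu> $ x" if "x \<in> S" for x
      using \<mu> that by (auto simp: support_class_def prob_simplex_def less_le)
    have zero: "p $ x = 0" "q $ x = 0" if "x \<notin> S" for x
      using p q that by (auto simp: face_def)
    \<comment> \<open>Outside \<open>S\<close> both points vanish, so a coordinate where they differ
      lies in \<open>S\<close> and has \<open>\<mu> $ x > 0\<close>; the midpoint inequality then
      applies with \<open>c = \<mu> $ x\<close>.\<close>
    have less: "2 * (m $ x * ln (m $ x / \<mu> $ x)) < p $ x * ln (p $ x / \<mu> $ x) + q $ x * ln (q $ x / \<mu> $ x)"
      if "p $ x \<noteq> q $ x" for x
      using x_ln_x_midpoint_less[OF nonneg that \<mu>_pos] zero[of x] that by (cases "x \<in> S") (auto simp: m_def)
    have "2 * entropy_sum m \<mu> < entropy_sum p \<mu> + entropy_sum q \<mu>"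
      unfolding entropy_sum_def sum_distrib_left sum.distrib[symmetric]
    proof (rule sum_strict_mono_ex1)
      show "\<forall>x\<in>UNIV. 2 * (m $ x * ln (m $ x / \<mu> $ x))
          \<le> p $ x * ln (p $ x / \<mu> $ x) + q $ x * ln (q $ x / \<mu> $ x)"
      proof
        fix x
        show "2 * (m $ x * ln (m $ x / \<mu> $ x))
            \<le> p $ x * ln (p $ x / \<mu> $ x) + q $ x * ln (q $ x / \<mu> $ x)"
          using less[of x] by (cases "p $ x = q $ x") (auto simp: m_def)
      qed
    qed (use less y in auto)
    then show False using p q m by fastforce
  qed
  have "is_arg_min (\<lambda>q. rel_entropy q \<mu>) (\<lambda>q. q \<in> E) q \<longleftrightarrow> ?min q" for q
  proof -
    have sub: "face E S \<subseteq> E" by (auto simp: face_def)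
    obtain p where p: "p \<in> face E S" using ne by blast
    have rel: "rel_entropy y \<mu> = (if y \<in> face E S then ereal (entropy_sum y \<mu>) else \<infinity>)"
      if "y \<in> E" for y by (rule rel_entropy_support_class[OF \<mu> that])
    show ?thesis
    proof
      assume L: "is_arg_min (\<lambda>q. rel_entropy q \<mu>) (\<lambda>q. q \<in> E) q"
      then have q: "q \<in> E" and le: "\<And>y. y \<in> E \<Longrightarrow> rel_entropy q \<mu> \<le> rel_entropy y \<mu>"
        by (auto simp: is_arg_min_linorder)
      have "p \<in> E" using p sub by blast
      \<comment> \<open>The point \<open>p\<close> of the face has finite entropy, so a minimizer
        over \<open>E\<close> has finite entropy as well, which confines it to the face.\<close>
      then have "q \<in> face E S"
        using le[of p] q p rel[of q] rel[of p] by (auto split: if_splits)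
      then show "?min q"
        using le rel sub by (metis ereal_less_eq(3) subsetD)
    next
      assume "?min q"
      then show "is_arg_min (\<lambda>q. rel_entropy q \<mu>) (\<lambda>q. q \<in> E) q"
        using sub rel by (auto simp: is_arg_min_linorder)
    qed
  qed
  then have "is_arg_min (\<lambda>q. rel_entropy q \<mu>) (\<lambda>q. q \<in> E) = ?min" by (intro ext)
  then have "proj_map E \<mu> = (SOME q. ?min q)"
    unfolding proj_map_def arg_min_def by (simp only:)
  then have "?min (proj_map E \<mu>)" by (rule ssubst) (rule someI_ex[OF ex])
  then show ?thesis using unique[of "proj_map E \<mu>" q] by metis
qed

text \<open>Every point of \<open>E\<close> has infinite entropy here and is therefore a minimizer,
  so the choice operator is applied to a predicate that does not mention \<open>\<mu>\<close>. The
  projection is constant on such a class.\<close>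

lemma proj_map_empty_face:
  assumes "face E S = {}" "\<mu> \<in> support_class S"
  shows "proj_map E \<mu> = (SOME q. q \<in> E)"
proof -
  have "is_arg_min (\<lambda>q. rel_entropy q \<mu>) (\<lambda>q. q \<in> E) = (\<lambda>q. q \<in> E)"
    using assms by (auto simp: fun_eq_iff is_arg_min_linorder rel_entropy_support_class[OF assms(2)])
  then show ?thesis by (simp add: proj_map_def arg_min_def)
qed

lemma Union_support_class: "prob_simplex = (\<Union>S. support_class S)"
proof -
  have "\<mu> \<in> support_class {x. \<mu> $ x \<noteq> 0}" if "\<mu> \<in> prob_simplex" for \<mu> :: "real^'a::finite"
    using that by (simp add: support_class_def)
  then have "prob_simplex \<subseteq> (\<Union>S. support_class S :: (real^'a::finite) set)" by blast
  moreover have "support_class S \<subseteq> prob_simplex" for S :: "'a::finite set"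
    by (auto simp: support_class_def)
  ultimately show ?thesis by blast
qed

lemma proj_map_in:
  assumes "E = constraint_set g \<alpha> r0 r" "E \<noteq> {}" "\<mu> \<in> prob_simplex"
  shows "proj_map E \<mu> \<in> E"
proof -
  obtain S where S: "\<mu> \<in> support_class S" using assms(3) Union_support_class by blast
  show ?thesis
  proof (cases "face E S = {}")
    case True
    then show ?thesis using proj_map_empty_face[OF True S] assms(2) by (simp add: some_in_eq)
  next
    case False
    then show ?thesis using proj_map_support_class[OF assms(1) False S] by (auto simp: face_def)
  qed
qed

text \<open>A function into a compact Hausdorff space is continuous as soon as its graph is closed.
  The graph is cut out by one closed condition for each competitor \<open>p\<close>: the entropy of
  the image does not exceed that of \<open>p\<close>. Uniqueness of the minimizer shows that no
  further pairs satisfy all of them.\<close>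

lemma continuous_on_proj_map_support_class:
  fixes g :: "nat \<Rightarrow> 'a::finite \<Rightarrow> real"
  assumes E_def: "E = constraint_set g \<alpha> r0 r"
  shows "continuous_on (support_class S) (proj_map E)"
proof (cases "face E S = {}")
  case True
  then show ?thesis
    using continuous_on_cong[OF refl proj_map_empty_face[OF True]] by simp
next
  case False
  let ?V = "support_class S" and ?K = "face E S"
  have E: "closed E" "E \<subseteq> prob_simplex"
    unfolding E_def by (rule closed_constraint_set constraint_set_subset)+
  note iff = proj_map_support_class[OF E_def False]
  have graph: "(\<lambda>\<mu>. (\<mu>, proj_map E \<mu>)) ` ?V =
      (\<Inter>p\<in>?K. (?V \<times> ?K) \<inter> (\<lambda>z. entropy_sum (snd z) (fst z) - entropy_sum p (fst z)) -` {..0})"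
    (is "?G = ?I")
  proof (intro equalityI subsetI)
    fix z assume "z \<in> ?G"
    then show "z \<in> ?I" using iff[of "fst z" "snd z"] by auto
  next
    fix z assume "z \<in> ?I"
    then show "z \<in> ?G" using iff[of "fst z" "snd z"] False by (auto simp: image_iff)
  qed
  have "closedin (top_of_set (?V \<times> ?K)) ?G"
    unfolding graph using False
    by (intro closedin_INT continuous_closedin_preimage continuous_on_diff
        continuous_on_entropy_sum[OF E(2), where S=S] continuous_on_fst continuous_on_snd
        continuous_on_const continuous_on_id) auto
  moreover have "proj_map E \<in> ?V \<rightarrow> ?K" using iff by auto
  ultimately show ?thesis
    using continuous_closed_graph_eq[OF compact_face[OF E], of "proj_map E" ?V S] by simp
qed

lemma space_simplex_borel [simp]: "space simplex_borel = prob_simplex"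
  by (simp add: simplex_borel_def space_restrict_space)

lemma measurable_proj_map:
  assumes E_def: "E = constraint_set g \<alpha> r0 r" and ne: "E \<noteq> {}"
  shows "proj_map E \<in> simplex_borel \<rightarrow>\<^sub>M simplex_borel"
proof -
  have "proj_map E \<in> simplex_borel \<rightarrow>\<^sub>M borel"
  proof (rule measurable_piecewise_restrict[where C="range support_class"])
    fix \<Omega> :: "(real^'a) set" assume "\<Omega> \<in> range support_class"
    then obtain S where S: "\<Omega> = support_class S" by auto
    have sub: "support_class S \<subseteq> prob_simplex" by (auto simp: support_class_def)
    show "\<Omega> \<inter> space simplex_borel \<in> sets simplex_borel"
      using borel_support_class[of S] S sub
      by (auto simp: simplex_borel_def sets_restrict_space space_restrict_space)
    have "restrict_space simplex_borel \<Omega> = restrict_space borel (support_class S)"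
      using S sub closed_prob_simplex
      unfolding simplex_borel_def
      by (subst restrict_restrict_space) (auto simp: borel_support_class borel_closed[OF closed_prob_simplex] Int_absorb1)
    then show "proj_map E \<in> borel_measurable (restrict_space simplex_borel \<Omega>)"
      using borel_measurable_continuous_on_restrict[OF continuous_on_proj_map_support_class[OF E_def]]
      by simp
  qed (use Union_support_class in \<open>auto intro: countable_finite\<close>)
  moreover have "proj_map E \<in> prob_simplex \<rightarrow> prob_simplex"
    using proj_map_in[OF E_def ne] constraint_set_subset E_def by blast
  ultimately show ?thesis
    by (auto simp: simplex_borel_def measurable_restrict_space2_iff space_restrict_space)
qed

section \<open>Independent identically distributed laws\<close>

lemma pmf_simplex_pmf: "q \<in> prob_simplex \<Longrightarrow> pmf (simplex_pmf q) x = q $ x"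
  unfolding simplex_pmf_def
  by (rule pmf_embed_pmf) (auto simp: prob_simplex_def nn_integral_count_space_finite)

lemma sets_iid_law: "sets (iid_law J q) = sets (seq_space J)"
  unfolding iid_law_def seq_space_def by (intro sets_PiM_cong) simp_all

lemma space_iid_law: "space (iid_law J q) = space (seq_space J)"
  by (rule sets_eq_imp_space_eq) (rule sets_iid_law)

lemma space_seq_space: "space (seq_space J) = (\<Pi>\<^sub>E i\<in>J. UNIV)"
  by (simp add: seq_space_def space_PiM)

lemma seq_space_finite: "finite J \<Longrightarrow> seq_space J = count_space (\<Pi>\<^sub>E i\<in>J. (UNIV :: 'a::finite set))"
  unfolding seq_space_def by (rule count_space_PiM_finite) auto

lemma finite_space_seq_space: "finite J \<Longrightarrow> finite (space (seq_space J :: (nat \<Rightarrow> 'a::finite) measure))"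
  by (simp add: space_seq_space finite_PiE)

lemma prob_space_iid_law: "prob_space (iid_law J q)"
  unfolding iid_law_def by (intro prob_space_PiM prob_space_measure_pmf)

text \<open>The probability of a cylinder is a polynomial in the coordinates of \<open>q\<close>.
  Both the measurability of the product law in its parameter and the formula for its point masses
  come from this.\<close>

lemma emeasure_iid_law_cylinder:
  assumes q: "q \<in> prob_simplex" and K: "K \<subseteq> J" "finite K"
  shows "emeasure (iid_law J q) (prod_emb J (\<lambda>_. count_space UNIV) K (Pi\<^sub>E K B)) =
      (\<Prod>i\<in>K. ennreal (\<Sum>x\<in>B i. q $ x))"
proof -
  interpret product_prob_space "\<lambda>_. measure_pmf (simplex_pmf q)" J
    by unfold_locales
  have "prod_emb J (\<lambda>_. count_space UNIV) K (Pi\<^sub>E K B) =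
      prod_emb J (\<lambda>_. measure_pmf (simplex_pmf q)) K (Pi\<^sub>E K B)"
    by (simp add: prod_emb_def)
  then have "emeasure (iid_law J q) (prod_emb J (\<lambda>_. count_space UNIV) K (Pi\<^sub>E K B)) =
      (\<Prod>i\<in>K. emeasure (measure_pmf (simplex_pmf q)) (B i))"
    unfolding iid_law_def using emeasure_PiM_emb[OF K] by simp
  then show ?thesis
    by (simp add: measure_pmf.emeasure_eq_measure measure_measure_pmf_finite pmf_simplex_pmf[OF q])
qed

lemma measure_iid_law_point:
  assumes q: "q \<in> prob_simplex" and J: "finite J" and y: "y \<in> space (seq_space J)"
  shows "measure (iid_law J q) {y} = (\<Prod>j\<in>J. q $ y j)"
proof -
  \<comment> \<open>For finite \<open>J\<close> a singleton is itself a cylinder with base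
    \<open>J\<close>: functions in the space are \<open>undefined\<close> off \<open>J\<close>, so
    they are determined by these coordinates.\<close>
  have "prod_emb J (\<lambda>_. count_space UNIV) J (\<Pi>\<^sub>E j\<in>J. {y j}) = {y}"
    using y by (auto simp: prod_emb_def space_seq_space PiE_iff extensional_def fun_eq_iff) metis
  then have "emeasure (iid_law J q) {y} = (\<Prod>j\<in>J. ennreal (q $ y j))"
    using emeasure_iid_law_cylinder[OF q order_refl J, of "\<lambda>j. {y j}"] by (simp only: sum.insert sum.empty) simp
  also have "\<dots> = ennreal (\<Prod>j\<in>J. q $ y j)"
    using q by (intro prod_ennreal) (auto simp: prob_simplex_def)
  finally show ?thesis
    using q by (simp add: measure_def prob_simplex_def prod_nonneg)
qed

lemma measurable_vec_nth_simplex [measurable]: "(\<lambda>q. q $ x) \<in> borel_measurable simplex_borel"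
  unfolding simplex_borel_def
  by (intro borel_measurable_continuous_on_restrict continuous_intros)

text \<open>\<open>prod_algebra\<close> is an intersection-stable generator, so the kernel only has
  to be checked on cylinders. This covers finite and infinite \<open>J\<close> alike.\<close>

lemma measurable_iid_law:
  "(iid_law J :: real^'a::finite \<Rightarrow> _) \<in> simplex_borel \<rightarrow>\<^sub>M prob_algebra (seq_space J)"
proof (rule measurable_prob_algebra_generated)
  let ?M = "\<lambda>_::nat. count_space (UNIV :: 'a set)"
  show "sets (seq_space J) = sigma_sets (\<Pi>\<^sub>E i\<in>J. space (?M i)) (prod_algebra J ?M)"
    unfolding seq_space_def by (rule sets_PiM)
  show "prod_algebra J ?M \<subseteq> Pow (\<Pi>\<^sub>E i\<in>J. space (?M i))" by (rule prod_algebra_sets_into_space)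
  fix B assume "B \<in> prod_algebra J ?M"
  then obtain K X where B: "B = prod_emb J ?M K (\<Pi>\<^sub>E j\<in>K. X j)" and K: "K \<subseteq> J" "finite K"
    by (rule prod_algebraE)
  have "(\<lambda>q. \<Prod>i\<in>K. ennreal (\<Sum>x\<in>X i. q $ x)) \<in> borel_measurable simplex_borel"
    by measurable
  then show "(\<lambda>q. emeasure (iid_law J q) B) \<in> borel_measurable simplex_borel"
    by (rule measurable_cong[THEN iffD1, rotated])
       (simp add: B emeasure_iid_law_cylinder[OF _ K])
qed (simp_all add: prob_space_iid_law sets_iid_law Int_stable_prod_algebra)

lemma measurable_reindex:
  assumes "f \<in> I \<rightarrow> K"
  shows "(\<lambda>\<omega>. \<lambda>n\<in>I. \<omega> (f n)) \<in> seq_space K \<rightarrow>\<^sub>M seq_space I"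
  using assms unfolding seq_space_def
  by (intro measurable_restrict measurable_component_singleton) auto

lemma measurable_restrict_seq_space:
  assumes "I \<subseteq> K"
  shows "(\<lambda>\<omega>. restrict \<omega> I) \<in> seq_space K \<rightarrow>\<^sub>M seq_space I"
  using measurable_reindex[of "\<lambda>n. n" I K] assms by (auto simp: restrict_def)

text \<open>Injectivity keeps the selected coordinates independent. The identity gives the
  marginals, a finite permutation acting on \<open>{1..}\<close> gives exchangeability, and a
  permutation of \<open>{1..N}\<close> gives the symmetry of the finite horizon.\<close>

lemma distr_iid_law_reindex:
  assumes "inj_on f I" "f \<in> I \<rightarrow> K"
  shows "distr (iid_law K q) (seq_space I) (\<lambda>\<omega>. \<lambda>n\<in>I. \<omega> (f n)) = iid_law I q"
proof -
  have "distr (iid_law K q) (seq_space I) (\<lambda>\<omega>. \<lambda>n\<in>I. \<omega> (f n)) =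
      distr (iid_law K q) (iid_law I q) (\<lambda>\<omega>. \<lambda>n\<in>I. \<omega> (f n))"
    by (intro distr_cong) (simp_all add: sets_iid_law)
  then show ?thesis
    using distr_PiM_reindex[of K "\<lambda>_. measure_pmf (simplex_pmf q)", OF _ assms]
    by (simp add: iid_law_def prob_space_measure_pmf)
qed

section \<open>Mixtures of i.i.d. laws: marginals, exchangeability, uniqueness\<close>

lemma distr_iid_mixture_reindex:
  assumes \<nu>: "prob_space \<nu>" "sets \<nu> = sets simplex_borel"
    and f: "inj_on f I" "f \<in> I \<rightarrow> K"
  shows "distr (iid_mixture K \<nu>) (seq_space I) (\<lambda>\<omega>. \<lambda>n\<in>I. \<omega> (f n)) = iid_mixture I \<nu>"
proof -
  have "iid_law K \<in> \<nu> \<rightarrow>\<^sub>M subprob_algebra (seq_space K)"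
    using measurable_prob_algebraD[OF measurable_iid_law] by (simp cong: measurable_cong_sets add: \<nu>(2))
  then have "distr (\<nu> \<bind> iid_law K) (seq_space I) (\<lambda>\<omega>. \<lambda>n\<in>I. \<omega> (f n)) =
      \<nu> \<bind> (\<lambda>q. distr (iid_law K q) (seq_space I) (\<lambda>\<omega>. \<lambda>n\<in>I. \<omega> (f n)))"
    by (rule distr_bind) (use prob_space.not_empty[OF \<nu>(1)] measurable_reindex[OF f(2)] in auto)
  then show ?thesis
    unfolding iid_mixture_def distr_iid_law_reindex[OF f] .
qed

lemma distr_iid_mixture_restrict:
  assumes "prob_space \<nu>" "sets \<nu> = sets simplex_borel" "I \<subseteq> K"
  shows "distr (iid_mixture K \<nu>) (seq_space I) (\<lambda>\<omega>. restrict \<omega> I) = iid_mixture I \<nu>"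
  using distr_iid_mixture_reindex[OF assms(1,2), of "\<lambda>n. n" I K] assms(3)
  by (auto simp: restrict_def)

lemma
  assumes "prob_space \<nu>" "sets \<nu> = sets simplex_borel"
  shows prob_space_iid_mixture: "prob_space (iid_mixture J \<nu>)"
    and sets_iid_mixture: "sets (iid_mixture J \<nu>) = sets (seq_space J)"
proof -
  have \<nu>: "\<nu> \<in> space (prob_algebra simplex_borel)" using assms by (simp add: space_prob_algebra)
  show "prob_space (iid_mixture J \<nu>)" "sets (iid_mixture J \<nu>) = sets (seq_space J)"
    unfolding iid_mixture_def
    using prob_space_bind'[OF \<nu> measurable_iid_law] sets_bind'[OF \<nu> measurable_iid_law] by auto
qed

lemma projectively_consistent_iid_mixture:
  assumes "prob_space \<nu>" "sets \<nu> = sets simplex_borel"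
  shows "projectively_consistent (\<lambda>m. iid_mixture {1..m} \<nu>)"
  unfolding projectively_consistent_def
  using prob_space_iid_mixture[OF assms] sets_iid_mixture[OF assms] distr_iid_mixture_restrict[OF assms]
  by auto

lemma sequence_law_with_marginals_iid_mixture:
  assumes "prob_space \<nu>" "sets \<nu> = sets simplex_borel"
  shows "sequence_law_with_marginals (\<lambda>m. iid_mixture {1..m} \<nu>) (iid_mixture {1..} \<nu>)"
  unfolding sequence_law_with_marginals_def
  using prob_space_iid_mixture[OF assms] sets_iid_mixture[OF assms] distr_iid_mixture_restrict[OF assms]
  by auto

lemma exchangeable_law_iid_mixture:
  assumes "prob_space \<nu>" "sets \<nu> = sets simplex_borel"
  shows "exchangeable_law (iid_mixture {1..} \<nu>)"
  unfolding exchangeable_law_def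
proof (intro conjI allI impI prob_space_iid_mixture sets_iid_mixture assms)
  fix n and \<pi> :: "nat \<Rightarrow> nat" assume \<pi>: "\<pi> permutes {1..n}"
  have "\<pi> i \<in> {1..}" if "i \<in> {1..}" for i
    using permutes_in_image[OF \<pi>, of i] permutes_not_in[OF \<pi>, of i] that by (cases "i \<le> n") auto
  then show "distr (iid_mixture {1..} \<nu>) (seq_space {1..}) (\<lambda>x. \<lambda>i\<in>{1..}. x (\<pi> i)) = iid_mixture {1..} \<nu>"
    by (intro distr_iid_mixture_reindex assms permutes_inj_on[OF \<pi>]) auto
qed

text \<open>A cylinder depends on finitely many coordinates, so its mass is read off from one of the
  prescribed marginals, and the masses of cylinders determine a finite measure. Existence is
  supplied separately by the mixture over infinite sequences.\<close>

lemma sequence_law_with_marginals_unique: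
  fixes L :: "(nat \<Rightarrow> 'a::finite) measure"
  assumes L: "sequence_law_with_marginals P L" and L': "sequence_law_with_marginals P L'"
  shows "L = L'"
proof (rule measure_eqI_PiM_infinite)
  let ?C = "\<lambda>_::nat. count_space (UNIV :: 'a set)"
  show "sets L = sets (Pi\<^sub>M {1..} ?C)" "sets L' = sets (Pi\<^sub>M {1..} ?C)"
    using L L' by (simp_all add: sequence_law_with_marginals_def seq_space_def)
  show "finite_measure L"
    using L by (simp add: sequence_law_with_marginals_def prob_space.finite_measure)
  fix B and K :: "nat set" assume K: "finite K" "K \<subseteq> {1..}"
  \<comment> \<open>The base \<open>K\<close> may be empty, while marginals are prescribed only for
    \<open>m \<ge> 1\<close>; inserting 1 covers this case and keeps \<open>Max\<close>
    meaningful.\<close>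
  define m where "m = Max (insert 1 K)"
  have m: "K \<subseteq> {1..m}" "1 \<le> m" using K by (auto simp: m_def)
  define C where "C = prod_emb {1..m} ?C K (Pi\<^sub>E K B)"
  have C: "C \<in> sets (seq_space {1..m})"
    unfolding C_def seq_space_def using m K by (intro sets_PiM_I) auto
  have pre: "(\<lambda>x. restrict x {1..m}) -` C \<inter> space (seq_space {1..}) = prod_emb {1..} ?C K (Pi\<^sub>E K B)"
    using m by (auto simp: C_def prod_emb_def space_seq_space Int_absorb1)
  have "emeasure Q (prod_emb {1..} ?C K (Pi\<^sub>E K B)) = emeasure (P m) C"
    if "sequence_law_with_marginals P Q" for Q
  proof -
    have sets: "sets Q = sets (seq_space {1..})"
      and marg: "distr Q (seq_space {1..m}) (\<lambda>x. restrict x {1..m}) = P m"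
      using that m by (auto simp: sequence_law_with_marginals_def)
    have meas: "(\<lambda>x. restrict x {1..m}) \<in> Q \<rightarrow>\<^sub>M seq_space {1..m}"
      using measurable_restrict_seq_space[of "{1..m}" "{1..}"]
      by (auto cong: measurable_cong_sets simp: sets)
    show ?thesis
      unfolding marg[symmetric] emeasure_distr[OF meas C] sets_eq_imp_space_eq[OF sets] pre ..
  qed
  then show "emeasure L (prod_emb {1..} ?C K (Pi\<^sub>E K B)) = emeasure L' (prod_emb {1..} ?C K (Pi\<^sub>E K B))"
    using L L' by simp
qed

section \<open>Joint laws and directing measures\<close>

text \<open>The kernel is only required to be a subprobability kernel, because a constrained
  component is the null measure at parameters that give the event probability zero. The iterated
  integral is the source of the later computations with joint laws.\<close>

lemma
  assumes \<nu>: "sets \<nu> = sets simplex_borel"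
    and K: "K \<in> simplex_borel \<rightarrow>\<^sub>M subprob_algebra (seq_space J)"
  shows nn_integral_joint_law: "f \<in> borel_measurable (simplex_borel \<Otimes>\<^sub>M seq_space J) \<Longrightarrow>
      (\<integral>\<^sup>+w. f w \<partial>joint_law J \<nu> K) = (\<integral>\<^sup>+\<mu>. \<integral>\<^sup>+x. f (\<mu>, x) \<partial>K \<mu> \<partial>\<nu>)"
    and sets_joint_law: "space \<nu> \<noteq> {} \<Longrightarrow> sets (joint_law J \<nu> K) = sets (simplex_borel \<Otimes>\<^sub>M seq_space J)"
proof -
  let ?P = "simplex_borel \<Otimes>\<^sub>M seq_space J"
  let ?k = "\<lambda>\<mu>. K \<mu> \<bind> (\<lambda>x. return ?P (\<mu>, x))"
  have k: "?k \<in> simplex_borel \<rightarrow>\<^sub>M subprob_algebra ?P"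
    by (rule measurable_bind[OF K]) measurable
  show "sets (joint_law J \<nu> K) = sets ?P" if "space \<nu> \<noteq> {}"
    unfolding joint_law_def
    by (intro sets_bind sets_kernel[OF k] that) (simp add: sets_eq_imp_space_eq[OF \<nu>])
  assume f: "f \<in> borel_measurable ?P"
  have "(\<integral>\<^sup>+w. f w \<partial>joint_law J \<nu> K) = (\<integral>\<^sup>+\<mu>. \<integral>\<^sup>+w. f w \<partial>?k \<mu> \<partial>\<nu>)"
    unfolding joint_law_def using k
    by (intro nn_integral_bind[OF f]) (simp cong: measurable_cong_sets add: \<nu>)
  also have "\<dots> = (\<integral>\<^sup>+\<mu>. \<integral>\<^sup>+x. f (\<mu>, x) \<partial>K \<mu> \<partial>\<nu>)"
  proof (rule nn_integral_cong)
    fix \<mu> assume "\<mu> \<in> space \<nu>"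
    then have \<mu>: "\<mu> \<in> space simplex_borel" using sets_eq_imp_space_eq[OF \<nu>] by simp
    note [measurable_cong] = sets_kernel[OF K \<mu>]
    have [measurable]: "\<mu> \<in> space simplex_borel" by (rule \<mu>)
    have "(\<integral>\<^sup>+w. f w \<partial>?k \<mu>) = (\<integral>\<^sup>+x. \<integral>\<^sup>+w. f w \<partial>return ?P (\<mu>, x) \<partial>K \<mu>)"
      by (rule nn_integral_bind[OF f]) measurable
    also have "\<dots> = (\<integral>\<^sup>+x. f (\<mu>, x) \<partial>K \<mu>)"
      using \<mu> sets_eq_imp_space_eq[OF sets_kernel[OF K \<mu>]]
      by (intro nn_integral_cong nn_integral_return f) (simp add: space_pair_measure)
    finally show "(\<integral>\<^sup>+w. f w \<partial>?k \<mu>) = (\<integral>\<^sup>+x. f (\<mu>, x) \<partial>K \<mu>)" .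
  qed
  finally show "(\<integral>\<^sup>+w. f w \<partial>joint_law J \<nu> K) = (\<integral>\<^sup>+\<mu>. \<integral>\<^sup>+x. f (\<mu>, x) \<partial>K \<mu> \<partial>\<nu>)" .
qed

text \<open>A common formula for several images of joint laws: \<open>h\<close> will be
  \<open>fst\<close>, \<open>snd\<close> or a block of \<open>snd\<close>.\<close>

lemma emeasure_distr_joint_law:
  assumes \<nu>: "sets \<nu> = sets simplex_borel" "space \<nu> \<noteq> {}"
    and K: "K \<in> simplex_borel \<rightarrow>\<^sub>M subprob_algebra (seq_space J)"
    and h: "h \<in> simplex_borel \<Otimes>\<^sub>M seq_space J \<rightarrow>\<^sub>M R" and B: "B \<in> sets R"
  shows "emeasure (distr (joint_law J \<nu> K) R h) B =
      (\<integral>\<^sup>+\<mu>. emeasure (K \<mu>) {x \<in> space (seq_space J). h (\<mu>, x) \<in> B} \<partial>\<nu>)"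
proof -
  note sets_J = sets_joint_law[OF \<nu>(1) K \<nu>(2)]
  have h': "h \<in> joint_law J \<nu> K \<rightarrow>\<^sub>M R" using h by (simp cong: measurable_cong_sets add: sets_J)
  have ind: "(\<lambda>w. indicator B (h w) :: ennreal) \<in> borel_measurable (simplex_borel \<Otimes>\<^sub>M seq_space J)"
    using h B by measurable
  have "emeasure (distr (joint_law J \<nu> K) R h) B = (\<integral>\<^sup>+y. indicator B y \<partial>distr (joint_law J \<nu> K) R h)"
    using B by simp
  also have "\<dots> = (\<integral>\<^sup>+w. indicator B (h w) \<partial>joint_law J \<nu> K)"
    using B by (intro nn_integral_distr[OF h']) auto
  also have "\<dots> = (\<integral>\<^sup>+\<mu>. \<integral>\<^sup>+x. indicator B (h (\<mu>, x)) \<partial>K \<mu> \<partial>\<nu>)"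
    by (rule nn_integral_joint_law[OF \<nu>(1) K ind])
  also have "\<dots> = (\<integral>\<^sup>+\<mu>. emeasure (K \<mu>) {x \<in> space (seq_space J). h (\<mu>, x) \<in> B} \<partial>\<nu>)"
  proof (rule nn_integral_cong)
    fix \<mu> assume "\<mu> \<in> space \<nu>"
    then have \<mu>: "\<mu> \<in> space simplex_borel" using sets_eq_imp_space_eq[OF \<nu>(1)] by simp
    note sets_K = sets_kernel[OF K \<mu>]
    have "(\<lambda>x. h (\<mu>, x)) \<in> seq_space J \<rightarrow>\<^sub>M R"
      using h \<mu> by (rule measurable_compose_Pair1[rotated])
    then have "{x \<in> space (seq_space J). h (\<mu>, x) \<in> B} \<in> sets (K \<mu>)"
      unfolding sets_K using B by measurable
    then have "emeasure (K \<mu>) {x \<in> space (seq_space J). h (\<mu>, x) \<in> B} =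
        (\<integral>\<^sup>+x. indicator {x \<in> space (seq_space J). h (\<mu>, x) \<in> B} x \<partial>K \<mu>)" by simp
    also have "\<dots> = (\<integral>\<^sup>+x. indicator B (h (\<mu>, x)) \<partial>K \<mu>)"
      using sets_eq_imp_space_eq[OF sets_K] by (intro nn_integral_cong) (simp add: indicator_def)
    finally show "(\<integral>\<^sup>+x. indicator B (h (\<mu>, x)) \<partial>K \<mu>) =
        emeasure (K \<mu>) {x \<in> space (seq_space J). h (\<mu>, x) \<in> B}" ..
  qed
  finally show ?thesis .
qed

text \<open>The sigma-algebra generated by \<open>T \<mu>\<close> may be strictly coarser than that
  of \<open>\<mu>\<close>. It still carries the conditional law, because the law of the sequence
  given \<open>\<mu>\<close> depends on \<open>\<mu>\<close> only through \<open>T \<mu>\<close>.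
  The conditional expectation is identified by its integrals over generated events, which are
  preimages of sets \<open>D\<close> in the simplex.\<close>

lemma
  assumes \<nu>: "prob_space \<nu>" "sets \<nu> = sets simplex_borel"
    and T: "T \<in> simplex_borel \<rightarrow>\<^sub>M simplex_borel"
  defines "J \<equiv> joint_law {1..} \<nu> (\<lambda>\<mu>. iid_law {1..} (T \<mu>))"
  shows prob_space_joint_iid: "prob_space J"
    and distr_fst_joint_iid: "distr J simplex_borel fst = \<nu>"
    and distr_snd_joint_iid: "distr J (seq_space {1..}) snd = iid_mixture {1..} (distr \<nu> simplex_borel T)"
    and directs_joint_iid: "directs J (\<lambda>w. T (fst w)) snd"
proof -
  let ?S = "seq_space {1..} :: (nat \<Rightarrow> 'a) measure"
  let ?P = "simplex_borel \<Otimes>\<^sub>M ?S"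
  let ?K = "\<lambda>\<mu>. iid_law {1..} (T \<mu>)"
  have ne: "space \<nu> \<noteq> {}" by (rule prob_space.not_empty[OF \<nu>(1)])
  have K: "?K \<in> simplex_borel \<rightarrow>\<^sub>M subprob_algebra ?S"
    using measurable_compose[OF T measurable_prob_algebraD[OF measurable_iid_law]] .
  have T\<nu>: "T \<in> \<nu> \<rightarrow>\<^sub>M simplex_borel" using T by (simp cong: measurable_cong_sets add: \<nu>(2))
  note sets_J = sets_joint_law[OF \<nu>(2) K ne, folded J_def]
  note emeasure_J = emeasure_distr_joint_law[OF \<nu>(2) ne K, folded J_def]
  interpret \<nu>: prob_space \<nu> by fact
  interpret K: prob_space "?K \<mu>" for \<mu> by (rule prob_space_iid_law)
  show fst: "distr J simplex_borel fst = \<nu>"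
  proof (rule measure_eqI)
    fix B assume B: "B \<in> sets (distr J simplex_borel fst)"
    have "emeasure (distr J simplex_borel fst) B = (\<integral>\<^sup>+\<mu>. emeasure (?K \<mu>) {x \<in> space ?S. \<mu> \<in> B} \<partial>\<nu>)"
      using B by (subst emeasure_J) auto
    also have "\<dots> = (\<integral>\<^sup>+\<mu>. indicator B \<mu> \<partial>\<nu>)"
      using K.emeasure_space_1 by (intro nn_integral_cong) (auto simp: indicator_def space_iid_law)
    finally show "emeasure (distr J simplex_borel fst) B = emeasure \<nu> B"
      using B by (simp add: \<nu>(2))
  qed (simp add: \<nu>(2))
  have fst_meas: "fst \<in> J \<rightarrow>\<^sub>M simplex_borel" and snd_meas: "snd \<in> J \<rightarrow>\<^sub>M ?S"
    by (simp_all cong: measurable_cong_sets add: sets_J)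
  show J: "prob_space J"
    by (rule prob_space_distrD[OF fst_meas]) (simp add: fst \<nu>(1))
  show "distr J ?S snd = iid_mixture {1..} (distr \<nu> simplex_borel T)"
  proof (rule measure_eqI)
    have mix: "iid_mixture {1..} (distr \<nu> simplex_borel T) = \<nu> \<bind> ?K"
      unfolding iid_mixture_def
      by (rule bind_distr[OF T\<nu> measurable_prob_algebraD[OF measurable_iid_law] ne])
    have K\<nu>: "?K \<in> \<nu> \<rightarrow>\<^sub>M subprob_algebra ?S" using K by (simp cong: measurable_cong_sets add: \<nu>(2))
    show "sets (distr J ?S snd) = sets (iid_mixture {1..} (distr \<nu> simplex_borel T))"
      using sets_iid_mixture[OF \<nu>.prob_space_distr[OF T\<nu>]] by simp
    fix B assume "B \<in> sets (distr J ?S snd)"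
    then have B: "B \<in> sets ?S" by simp
    have "{x \<in> space ?S. x \<in> B} = B" using sets.sets_into_space[OF B] by blast
    then show "emeasure (distr J ?S snd) B = emeasure (iid_mixture {1..} (distr \<nu> simplex_borel T)) B"
      unfolding mix emeasure_bind[OF ne K\<nu> B] emeasure_J[OF measurable_snd B] by simp
  qed
  interpret J: prob_space J by (rule J)
  let ?Q = "\<lambda>w. T (fst w)"
  have Q: "?Q \<in> J \<rightarrow>\<^sub>M simplex_borel" using measurable_compose[OF fst_meas T] .
  let ?F = "vimage_algebra (space J) ?Q simplex_borel"
  show "directs J ?Q snd"
    unfolding directs_def
  proof (intro conjI ballI Q snd_meas)
    fix B assume B: "B \<in> sets ?S"
    have sets_F: "sets ?F = {?Q -` D \<inter> space J |D. D \<in> sets simplex_borel}"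
      by (rule sets_vimage_algebra2) (use measurable_space[OF Q] in auto)
    have sub: "subalgebra J ?F"
      unfolding subalgebra_def sets_F using measurable_sets[OF Q] by auto
    interpret finite_measure_subalgebra J ?F by unfold_locales (rule sub)
    let ?m = "\<lambda>w. measure (iid_law {1..} (?Q w)) B"
    have m: "(\<lambda>q. measure (iid_law {1..} q) B) \<in> borel_measurable simplex_borel"
      using measurable_compose[OF measurable_iid_law measurable_measure_prob_algebra[OF B]] .
    have mF: "?m \<in> borel_measurable ?F"
      by (rule measurable_compose[OF measurable_vimage_algebra1 m]) (use measurable_space[OF Q] in auto)
    have mJ: "?m \<in> borel_measurable J"
      by (rule measurable_compose[OF Q m])
    have snd_B: "snd -` B \<inter> space J \<in> sets J" using snd_meas B by (rule measurable_sets)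
    show "AE w in J. real_cond_exp J ?F (indicator (snd -` B \<inter> space J)) w = ?m w"
    proof (rule real_cond_exp_charact)
      show "integrable J (indicator (snd -` B \<inter> space J) :: _ \<Rightarrow> real)"
        using snd_B by (simp add: integrable_indicator_iff J.emeasure_finite less_top[symmetric])
      show int_m: "integrable J ?m"
        by (rule J.integrable_const_bound[where B=1]) (use mJ prob_space.prob_le_1[OF prob_space_iid_law] in auto)
      fix C assume "C \<in> sets ?F"
      then obtain D where D: "D \<in> sets simplex_borel" and C: "C = ?Q -` D \<inter> space J"
        unfolding sets_F by auto
      have C_J: "C \<in> sets J" unfolding C using Q D by (rule measurable_sets)
      have "emeasure J (C \<inter> (snd -` B \<inter> space J)) = (\<integral>\<^sup>+w. indicator D (?Q w) * indicator B (snd w) \<partial>J)"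
      proof -
        have "emeasure J (C \<inter> (snd -` B \<inter> space J)) = (\<integral>\<^sup>+w. indicator (C \<inter> (snd -` B \<inter> space J)) w \<partial>J)"
          using C_J snd_B by simp
        also have "\<dots> = (\<integral>\<^sup>+w. indicator D (?Q w) * indicator B (snd w) \<partial>J)"
          by (intro nn_integral_cong) (auto simp: C indicator_def)
        finally show ?thesis .
      qed
      also have "\<dots> = (\<integral>\<^sup>+\<mu>. \<integral>\<^sup>+x. indicator D (T \<mu>) * indicator B x \<partial>?K \<mu> \<partial>\<nu>)"
        unfolding J_def using D B T by (subst nn_integral_joint_law[OF \<nu>(2) K]) simp_all
      \<comment> \<open>For fixed \<open>\<mu>\<close> the factor
        \<open>indicator D (T \<mu>)\<close> is constant and leaves the inner integral, which
        becomes the mass of \<open>B\<close>.\<close>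
      also have "\<dots> = (\<integral>\<^sup>+\<mu>. indicator D (T \<mu>) * ennreal (measure (?K \<mu>) B) \<partial>\<nu>)"
      proof (rule nn_integral_cong)
        fix \<mu>
        have "B \<in> sets (?K \<mu>)" using B by (simp only: sets_iid_law)
        then show "(\<integral>\<^sup>+x. indicator D (T \<mu>) * indicator B x \<partial>?K \<mu>) =
            indicator D (T \<mu>) * ennreal (measure (?K \<mu>) B)"
          by (subst nn_integral_cmult) (auto simp: K.emeasure_eq_measure simp del: One_nat_def)
      qed
      \<comment> \<open>Since \<open>\<nu>\<close> is the law of the first component, the integral
        over parameters is carried back to \<open>J\<close>, where the integrand is a function of
        \<open>?Q\<close>.\<close>
      also have "\<dots> = (\<integral>\<^sup>+\<mu>. indicator D (T \<mu>) * ennreal (measure (?K \<mu>) B) \<partial>distr J simplex_borel fst)"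
        by (simp add: fst)
      also have "\<dots> = (\<integral>\<^sup>+w. indicator D (?Q w) * ennreal (?m w) \<partial>J)"
      proof (rule nn_integral_distr[OF fst_meas])
        have [measurable]: "(\<lambda>\<mu>. indicator D (T \<mu>) :: ennreal) \<in> borel_measurable simplex_borel"
          by (rule measurable_compose[OF T borel_measurable_indicator[OF D]])
        note [measurable] = measurable_compose[OF T m]
        show "(\<lambda>\<mu>. indicator D (T \<mu>) * ennreal (measure (?K \<mu>) B))
            \<in> borel_measurable (distr J simplex_borel fst)"
          unfolding measurable_distr_eq1 by measurable
      qed
      also have "\<dots> = (\<integral>\<^sup>+w. ennreal (indicator C w * ?m w) \<partial>J)"
        by (intro nn_integral_cong) (auto simp: C indicator_def)
      also have "\<dots> = ennreal (\<integral>w. indicator C w * ?m w \<partial>J)"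
        using integrable_real_mult_indicator[OF C_J int_m]
        by (intro nn_integral_eq_integral AE_I2) (auto simp: mult.commute)
      finally have "measure J (C \<inter> (snd -` B \<inter> space J)) = (\<integral>w. indicator C w * ?m w \<partial>J)"
        by (simp add: measure_def integral_nonneg_AE)
      moreover have "(\<integral>w\<in>C. indicator (snd -` B \<inter> space J) w \<partial>J) = measure J (C \<inter> (snd -` B \<inter> space J))"
      proof -
        have "(\<integral>w\<in>C. indicator (snd -` B \<inter> space J) w \<partial>J) =
            (\<integral>w. (indicator (C \<inter> (snd -` B \<inter> space J)) w :: real) \<partial>J)"
          unfolding set_lebesgue_integral_def by (intro Bochner_Integration.integral_cong) (auto simp: indicator_def)
        then show ?thesis using C_J snd_B by simp
      qed
      ultimately show "(\<integral>w\<in>C. indicator (snd -` B \<inter> space J) w \<partial>J) = (\<integral>w\<in>C. ?m w \<partial>J)"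
        by (simp add: set_lebesgue_integral_def)
    qed (rule mF)
  qed
qed

section \<open>Constrained component laws and the constraint posterior\<close>

lemma sets_seq_space_finite:
  "finite J \<Longrightarrow> B \<subseteq> space (seq_space J) \<Longrightarrow> B \<in> sets (seq_space J :: (nat \<Rightarrow> 'a::finite) measure)"
  by (simp add: seq_space_finite)

lemma measurable_seq_space_finite:
  assumes "finite J" "\<And>x. x \<in> space (seq_space J) \<Longrightarrow> h x \<in> space R"
  shows "h \<in> (seq_space J :: (nat \<Rightarrow> 'a::finite) measure) \<rightarrow>\<^sub>M R"
  using assms by (simp add: seq_space_finite)

lemma sets_empirical_event: "empirical_event A N \<in> sets (seq_space {1..N})"
  by (rule sets_seq_space_finite) (auto simp: empirical_event_def)

lemma measurable_emeasure_iid_law: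
  "B \<in> sets (seq_space J) \<Longrightarrow> (\<lambda>\<mu>. emeasure (iid_law J \<mu>) B) \<in> borel_measurable simplex_borel"
  using measurable_compose[OF measurable_prob_algebraD[OF measurable_iid_law]
      measurable_emeasure_subprob_algebra] .

lemma sets_constrained_component: "sets (constrained_component A N \<mu>) = sets (seq_space {1..N})"
  by (simp add: constrained_component_def sets_iid_law)

lemma space_constrained_component: "space (constrained_component A N \<mu>) = space (seq_space {1..N})"
  by (rule sets_eq_imp_space_eq) (rule sets_constrained_component)

lemma emeasure_constrained_component:
  assumes "B \<in> sets (seq_space {1..N})"
  shows "emeasure (constrained_component A N \<mu>) B =
      emeasure (iid_law {1..N} \<mu>) (empirical_event A N \<inter> B) / emeasure (iid_law {1..N} \<mu>) (empirical_event A N)"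
  unfolding constrained_component_def
  using assms sets_empirical_event by (intro emeasure_uniform_measure) (simp_all only: sets_iid_law)

text \<open>If the event has probability zero, the ratio is \<open>0 / 0\<close>, which is 0 in the
  extended nonnegative reals; otherwise it is 1. So the total mass is 0 or 1.\<close>

lemma subprob_space_constrained_component:
  fixes A :: "(real^'a::finite) set"
  shows "subprob_space (constrained_component A N \<mu>)"
proof -
  let ?E = "empirical_event A N"
  interpret prob_space "iid_law {1..N} \<mu>" by (rule prob_space_iid_law)
  have "emeasure (iid_law {1..N} \<mu>) ?E / emeasure (iid_law {1..N} \<mu>) ?E \<le> 1"
    by (cases "emeasure (iid_law {1..N} \<mu>) ?E = 0")
       (simp_all add: ennreal_divide_self less_top[symmetric] del: One_nat_def)
  moreover have "?E \<inter> space (seq_space {1..N}) = ?E" by (auto simp: empirical_event_def)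
  ultimately have "emeasure (constrained_component A N \<mu>) (space (constrained_component A N \<mu>)) \<le> 1"
    unfolding space_constrained_component emeasure_constrained_component[OF sets.top] by simp
  moreover have "space (constrained_component A N \<mu>) \<noteq> {}"
    using not_empty unfolding space_constrained_component space_iid_law .
  ultimately show ?thesis by (rule subprob_spaceI)
qed

lemma measurable_constrained_component:
  fixes A :: "(real^'a::finite) set"
  shows "constrained_component A N \<in> simplex_borel \<rightarrow>\<^sub>M subprob_algebra (seq_space {1..N})"
proof (rule measurable_subprob_algebra)
  fix \<mu> :: "real^'a"
  show "subprob_space (constrained_component A N \<mu>)" by (rule subprob_space_constrained_component)
  fix B :: "(nat \<Rightarrow> 'a) set" assume B: "B \<in> sets (seq_space {1..N})"
  note [measurable] = measurable_emeasure_iid_law[OF sets.Int[OF sets_empirical_event B]]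
    measurable_emeasure_iid_law[OF sets_empirical_event]
  show "(\<lambda>\<mu>. emeasure (constrained_component A N \<mu>) B) \<in> borel_measurable simplex_borel"
    unfolding emeasure_constrained_component[OF B] by measurable
qed (rule sets_constrained_component)

lemma prob_space_constraint_posterior:
  assumes \<rho>: "prob_space \<rho>" "sets \<rho> = sets simplex_borel" and pos: "0 < event_mass \<rho> A N"
  shows "prob_space (constraint_posterior \<rho> A N)"
proof
  interpret prob_space \<rho> by fact
  let ?p = "\<lambda>\<mu>. emeasure (iid_law {1..N} \<mu>) (empirical_event A N)"
  have [measurable]: "?p \<in> borel_measurable \<rho>"
    using measurable_emeasure_iid_law[OF sets_empirical_event] by (simp cong: measurable_cong_sets add: \<rho>(2))
  \<comment> \<open>The bound by 1 makes the normalizer finite: dividing it by itself gives 1 only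
    if it is neither 0 nor infinite.\<close>
  have "event_mass \<rho> A N \<le> (\<integral>\<^sup>+\<mu>. 1 \<partial>\<rho>)"
    unfolding event_mass_def
    by (rule nn_integral_mono, rule subprob_space.subprob_emeasure_le_1,
        rule prob_space_imp_subprob_space, rule prob_space_iid_law)
  then have fin[unfolded infinity_ennreal_def]: "event_mass \<rho> A N < \<infinity>"
    using emeasure_space_1 by (simp add: le_less_trans)
  have "emeasure (constraint_posterior \<rho> A N) (space (constraint_posterior \<rho> A N)) =
      (\<integral>\<^sup>+\<mu>. ?p \<mu> / event_mass \<rho> A N \<partial>\<rho>)"
  proof -
    have "(\<lambda>\<mu>. ?p \<mu> / event_mass \<rho> A N) \<in> borel_measurable \<rho>" by measurable
    then show ?thesis
      unfolding constraint_posterior_def space_density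
      by (subst emeasure_density) (auto intro!: nn_integral_cong simp del: One_nat_def)
  qed
  also have "\<dots> = event_mass \<rho> A N / event_mass \<rho> A N"
    unfolding event_mass_def by (rule nn_integral_divide) measurable
  finally show "emeasure (constraint_posterior \<rho> A N) (space (constraint_posterior \<rho> A N)) = 1"
    using pos fin by (simp add: ennreal_divide_self)
qed

lemma sets_constraint_posterior: "sets (constraint_posterior \<rho> A N) = sets \<rho>"
  by (simp add: constraint_posterior_def)

text \<open>The increasing enumeration of \<open>I\<close> is extended by an arbitrary bijection
  between the complements, which both have \<open>N - m\<close> elements. Permuting coordinates by
  \<open>f\<close> then moves the block \<open>I\<close> to the initial positions.\<close>

lemma bij_betw_extending_sorted_list:
  assumes I: "I \<subseteq> {1..N}" "card I = m"
  obtains f where "bij_betw f {1..N} {1..N}" "\<And>j. j \<in> {1..m} \<Longrightarrow> f j = sorted_list_of_set I ! (j - 1)"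
proof -
  have fin: "finite I" using I(1) by (rule finite_subset) simp
  have m: "m \<le> N" using card_mono[OF _ I(1)] I(2) by simp
  define s where "s = (\<lambda>j. sorted_list_of_set I ! (j - 1))"
  have nth: "bij_betw ((!) (sorted_list_of_set I)) {..<m} I"
    by (rule bij_betw_nth) (simp_all add: fin I(2))
  \<comment> \<open>Coordinates count from 1 and list positions from 0; \<open>Suc\<close> inverts
    the shift.\<close>
  have "bij_betw (\<lambda>j. j - 1) {1..m} {..<m}"
    by (rule bij_betwI[where g=Suc]) auto
  from bij_betw_trans[OF this nth] have s: "bij_betw s {1..m} I"
    by (simp add: s_def comp_def)
  have "card ({1..N} - {1..m}) = card ({1..N} - I)"
    using I m card_Diff_subset[OF fin I(1)] card_Diff_subset[of "{1..m}" "{1..N}"] by auto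
  then obtain h where h: "bij_betw h ({1..N} - {1..m}) ({1..N} - I)"
    using finite_same_card_bij[of "{1..N} - {1..m}" "{1..N} - I"] by auto
  define f where "f = (\<lambda>j. if j \<in> {1..m} then s j else h j)"
  have "bij_betw f ({1..m} \<union> ({1..N} - {1..m})) (I \<union> ({1..N} - I))"
    unfolding f_def by (rule bij_betw_disjoint_Un[OF s h]) auto
  moreover have "{1..m} \<union> ({1..N} - {1..m}) = {1..N}" "I \<union> ({1..N} - I) = {1..N}"
    using I m by auto
  ultimately have "bij_betw f {1..N} {1..N}" by (simp only:)
  moreover have "f j = sorted_list_of_set I ! (j - 1)" if "j \<in> {1..m}" for j
    using that by (simp add: f_def s_def)
  ultimately show thesis by (rule that)
qed

lemma empirical_reindex:
  assumes f: "bij_betw f {1..N} {1..N}"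
  shows "empirical N (\<lambda>n\<in>{1..N}. x (f n)) = empirical N x"
proof -
  have "card {i \<in> {1..N}. x (f i) = a} = card {i \<in> {1..N}. x i = a}" for a
  proof -
    have img: "f ` {i \<in> {1..N}. x (f i) = a} = {i \<in> {1..N}. x i = a}"
    proof (intro equalityI subsetI)
      fix i assume i: "i \<in> {i \<in> {1..N}. x i = a}"
      then have "i \<in> f ` {1..N}" using f by (simp add: bij_betw_def del: One_nat_def)
      then obtain n where "n \<in> {1..N}" "i = f n" by blast
      then show "i \<in> f ` {i \<in> {1..N}. x (f i) = a}" using i by blast
    next
      fix i assume "i \<in> f ` {i \<in> {1..N}. x (f i) = a}"
      then show "i \<in> {i \<in> {1..N}. x i = a}" using bij_betwE[OF f] by blast
    qed
    have "inj_on f {i \<in> {1..N}. x (f i) = a}"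
      by (rule inj_on_subset[OF bij_betw_imp_inj_on[OF f]]) blast
    from card_image[OF this] show ?thesis unfolding img by (rule sym)
  qed
  moreover have "{i \<in> {1..N}. (\<lambda>n\<in>{1..N}. x (f n)) i = a} = {i \<in> {1..N}. x (f i) = a}" for a
    by (rule Collect_cong) (metis restrict_apply)
  ultimately show ?thesis by (simp only: empirical_def)
qed

text \<open>Both the i.i.d. law and the conditioning event are invariant under permutations of the
  coordinates, so every block of the conditioned sequence has the law of the initial block.\<close>

lemma emeasure_constrained_component_block:
  assumes I: "I \<subseteq> {1..N}" "card I = m"
  shows "emeasure (constrained_component A N \<mu>) {x \<in> space (seq_space {1..N}). block I x = y} =
      emeasure (constrained_component A N \<mu>) {x \<in> space (seq_space {1..N}). restrict x {1..m} = y}"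
proof -
  obtain f where f: "bij_betw f {1..N} {1..N}"
    and fI: "\<And>j. j \<in> {1..m} \<Longrightarrow> f j = sorted_list_of_set I ! (j - 1)"
    using bij_betw_extending_sorted_list[OF I] by blast
  have m: "m \<le> N" using card_mono[OF _ I(1)] I(2) by simp
  let ?S = "seq_space {1..N} :: (nat \<Rightarrow> 'a) measure"
  let ?E = "empirical_event A N"
  let ?B = "{x \<in> space ?S. block I x = y}" and ?R = "{x \<in> space ?S. restrict x {1..m} = y}"
  define \<phi> where "\<phi> = (\<lambda>x :: nat \<Rightarrow> 'a. \<lambda>n\<in>{1..N}. x (f n))"
  have f': "inj_on f {1..N}" "f \<in> {1..N} \<rightarrow> {1..N}" using f by (auto simp: bij_betw_def)
  have \<phi>_space: "\<phi> x \<in> space ?S" for x by (simp add: \<phi>_def space_seq_space)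
  have \<phi>_block: "restrict (\<phi> x) {1..m} = block I x" for x
    using fI m I(2) by (auto simp: \<phi>_def block_def restrict_def fun_eq_iff)
  have \<phi>_emp: "empirical N (\<phi> x) = empirical N x" for x
    unfolding \<phi>_def by (rule empirical_reindex[OF f])
  have B: "?B \<in> sets ?S" and R: "?R \<in> sets ?S" by (auto intro!: sets_seq_space_finite)
  have \<phi>: "\<phi> \<in> iid_law {1..N} \<mu> \<rightarrow>\<^sub>M ?S"
    unfolding \<phi>_def using measurable_reindex[OF f'(2)] by (simp cong: measurable_cong_sets add: sets_iid_law)
  have "emeasure (iid_law {1..N} \<mu>) (?E \<inter> ?R) = emeasure (distr (iid_law {1..N} \<mu>) ?S \<phi>) (?E \<inter> ?R)"
    unfolding \<phi>_def distr_iid_law_reindex[OF f'] ..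
  also have "\<dots> = emeasure (iid_law {1..N} \<mu>) (\<phi> -` (?E \<inter> ?R) \<inter> space (iid_law {1..N} \<mu>))"
    using sets_empirical_event R by (intro emeasure_distr \<phi>) auto
  \<comment> \<open>The empirical measure is unchanged by \<open>\<phi>\<close>, and the initial
    block of \<open>\<phi> x\<close> is the block \<open>I\<close> of \<open>x\<close>, so the two
    events correspond. The denominator of the conditional probability is common to both
    sides.\<close>
  also have "\<phi> -` (?E \<inter> ?R) \<inter> space (iid_law {1..N} \<mu>) = ?E \<inter> ?B"
    using \<phi>_space \<phi>_emp
    by (auto simp only: space_iid_law empirical_event_def \<phi>_block Int_iff vimage_def mem_Collect_eq)
  finally show ?thesis by (simp only: emeasure_constrained_component B R)
qed

section \<open>Weak limits of locally continuous integrands\<close>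

text \<open>The complement of the support is covered by open sets of mass zero. Second countability
  replaces them by countably many basis sets, whose union is still null.\<close>

lemma AE_measure_support:
  fixes \<nu> :: "(real^'a::finite) measure"
  assumes \<nu>: "sets \<nu> = sets simplex_borel"
  shows "AE x in \<nu>. x \<in> measure_support \<nu>"
proof -
  obtain \<B> :: "(real^'a) set set" where \<B>: "countable \<B>" "topological_basis \<B>"
    using ex_countable_basis by blast
  define Z where "Z = {b \<in> \<B>. emeasure \<nu> (b \<inter> space \<nu>) = 0}"
  have sets: "U \<inter> space \<nu> \<in> sets \<nu>" if "open U" for U
    unfolding \<nu> sets_eq_imp_space_eq[OF \<nu>] space_simplex_borel
    unfolding simplex_borel_def sets_restrict_space Int_commute[of U]
    by (rule imageI) (rule borel_open[OF that])
  have "(\<Union>b\<in>Z. b \<inter> space \<nu>) \<in> null_sets \<nu>"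
    using \<B> sets topological_basis_open[OF \<B>(2)]
    by (intro null_sets_UN') (auto simp: Z_def null_sets_def)
  then show ?thesis
  proof (rule AE_I')
    show "{x \<in> space \<nu>. x \<notin> measure_support \<nu>} \<subseteq> (\<Union>b\<in>Z. b \<inter> space \<nu>)"
    proof safe
      fix x assume x: "x \<in> space \<nu>" "x \<notin> measure_support \<nu>"
      then obtain U where U: "open U" "x \<in> U" "emeasure \<nu> (U \<inter> space \<nu>) = 0"
        by (auto simp: measure_support_def not_less)
      obtain b where b: "b \<in> \<B>" "x \<in> b" "b \<subseteq> U"
        using topological_basisE[OF \<B>(2) U(1,2)] by blast
      have "emeasure \<nu> (b \<inter> space \<nu>) \<le> emeasure \<nu> (U \<inter> space \<nu>)"
        using b sets[OF U(1)] by (intro emeasure_mono) auto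
      then show "x \<in> (\<Union>b\<in>Z. b \<inter> space \<nu>)" using x b U by (auto simp: Z_def)
    qed
  qed
qed

lemma closedin_measure_support: "closedin (top_of_set (space \<nu>)) (measure_support \<nu>)"
proof -
  have "space \<nu> - measure_support \<nu> = space \<nu> \<inter> \<Union>{U. open U \<and> emeasure \<nu> (U \<inter> space \<nu>) = 0}"
    by (auto simp: measure_support_def not_less)
  moreover have "openin (top_of_set (space \<nu>)) (space \<nu> \<inter> \<Union>{U. open U \<and> emeasure \<nu> (U \<inter> space \<nu>) = 0})"
    by (intro openin_open_Int open_Union) auto
  ultimately show ?thesis
    by (auto simp: closedin_def measure_support_def)
qed

text \<open>Since \<open>f\<close> is bounded by 1, cutting it off by \<open>\<phi>\<close> changes
  its integral under \<open>R i\<close> by at most 1 minus the integral of \<open>\<phi>\<close>.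
  The cutoff is itself an admissible test function, and its integrals tend to 1, because it equals 1
  on the support, which has full mass in the limit.\<close>

lemma simplex_weak_conv_locally_continuous:
  fixes f :: "real^'a::finite \<Rightarrow> real"
  assumes conv: "simplex_weak_conv R \<nu> F"
    and R: "\<forall>\<^sub>F i in F. prob_space (R i) \<and> sets (R i) = sets simplex_borel"
    and \<nu>: "prob_space \<nu>" "sets \<nu> = sets simplex_borel"
    and U: "openin (top_of_set prob_simplex) U" "measure_support \<nu> \<subseteq> U" "continuous_on U f"
    and f: "f \<in> borel_measurable simplex_borel" "\<And>x. x \<in> prob_simplex \<Longrightarrow> \<bar>f x\<bar> \<le> 1"
  shows "((\<lambda>i. \<integral>x. f x \<partial>R i) \<longlongrightarrow> (\<integral>x. f x \<partial>\<nu>)) F"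
proof -
  have space_\<nu>: "space \<nu> = prob_simplex" using sets_eq_imp_space_eq[OF \<nu>(2)] by simp
  have "closedin (top_of_set prob_simplex) (measure_support \<nu>)"
    using closedin_measure_support[of \<nu>] by (simp add: space_\<nu>)
  moreover have "closedin (top_of_set prob_simplex) (prob_simplex - U)"
    using U(1) by (simp add: closedin_diff)
  ultimately obtain \<phi> :: "real^'a \<Rightarrow> real" where
    \<phi>: "continuous_on prob_simplex \<phi>" "\<And>x. x \<in> prob_simplex \<Longrightarrow> \<phi> x \<in> closed_segment 1 0"
      "\<And>x. x \<in> measure_support \<nu> \<Longrightarrow> \<phi> x = 1" "\<And>x. x \<in> prob_simplex - U \<Longrightarrow> \<phi> x = 0"
    by (rule Urysohn_local[where a="1::real" and b=0]) (use U(2) in auto)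
  have \<phi>_range: "0 \<le> \<phi> x" "\<phi> x \<le> 1" if "x \<in> prob_simplex" for x
    using \<phi>(2)[OF that] by (auto simp: closed_segment_eq_real_ivl)
  define h where "h = (\<lambda>x. f x * \<phi> x)"
  have U_sub: "U \<subseteq> prob_simplex" using openin_imp_subset[OF U(1)] .
  have cont_h: "continuous_on prob_simplex h"
    unfolding continuous_on_def
  proof
    fix x :: "real^'a" assume x: "x \<in> prob_simplex"
    show "(h \<longlongrightarrow> h x) (at x within prob_simplex)"
    proof (cases "x \<in> U")
      case True
      obtain V where V: "open V" "U = prob_simplex \<inter> V" using U(1) by (auto simp: openin_open)
      have "continuous_on U h"
        unfolding h_def using U(3) \<phi>(1) U_sub by (intro continuous_on_mult continuous_on_subset[OF \<phi>(1)])
      then have "(h \<longlongrightarrow> h x) (at x within U)" using True by (simp add: continuous_on_def)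
      moreover have "at x within U = at x within prob_simplex"
        using V True by (intro at_within_nhd[of x V]) auto
      ultimately show ?thesis by simp
    next
      \<comment> \<open>Outside \<open>U\<close> nothing is known about continuity of
        \<open>f\<close>, but \<open>\<bar>h\<bar> \<le> \<phi>\<close> and \<open>\<phi>\<close>
        tends to its value 0 at such a point.\<close>
      case False
      then have "\<phi> x = 0" using \<phi>(4) x by simp
      then have "(\<phi> \<longlongrightarrow> 0) (at x within prob_simplex)" using \<phi>(1) x by (auto simp: continuous_on_def)
      moreover have "\<forall>\<^sub>F y in at x within prob_simplex. norm (h y) \<le> \<phi> y"
        unfolding eventually_at_filter
      proof (rule always_eventually, intro allI impI)
        fix y :: "real^'a" assume "y \<in> prob_simplex"
        then show "norm (h y) \<le> \<phi> y"
          using mult_right_mono[OF f(2) \<phi>_range(1)] \<phi>_range(1) by (simp add: h_def abs_mult)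
      qed
      ultimately show ?thesis
        using Lim_null_comparison[of h \<phi>] \<open>\<phi> x = 0\<close> by (simp add: h_def)
    qed
  qed
  have h_le: "\<bar>h x\<bar> \<le> 1" if "x \<in> prob_simplex" for x
    using mult_mono[OF f(2) \<phi>_range(2)] \<phi>_range(1) that by (simp add: h_def abs_mult)
  have [measurable]: "\<phi> \<in> borel_measurable simplex_borel"
    unfolding simplex_borel_def by (rule borel_measurable_continuous_on_restrict[OF \<phi>(1)])
  note [measurable] = f(1)
  have int: "integrable P f" "integrable P h" "integrable P \<phi>"
    if "prob_space P" "sets P = sets simplex_borel" for P
  proof -
    interpret prob_space P by fact
    note [measurable_cong] = that(2)
    have sp: "space P = prob_simplex" using sets_eq_imp_space_eq[OF that(2)] by simp
    have "\<bar>\<phi> x\<bar> \<le> 1" if "x \<in> prob_simplex" for x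
      using \<phi>_range[OF that] by simp
    moreover have "h \<in> borel_measurable P" "f \<in> borel_measurable P" "\<phi> \<in> borel_measurable P"
      unfolding h_def by measurable
    ultimately show "integrable P f" "integrable P h" "integrable P \<phi>"
      using f(2) h_le by (intro integrable_const_bound[where B=1] AE_I2; simp add: sp)+
  qed
  have "((\<lambda>i. \<integral>x. h x \<partial>R i) \<longlongrightarrow> (\<integral>x. h x \<partial>\<nu>)) F"
    using conv cont_h h_le unfolding simplex_weak_conv_def by (auto simp: bounded_iff)
  moreover have "(\<integral>x. h x \<partial>\<nu>) = (\<integral>x. f x \<partial>\<nu>)"
    using AE_measure_support[OF \<nu>(2)] int[OF \<nu>]
    by (intro integral_cong_AE) (auto simp: h_def \<phi>(3) elim!: eventually_mono)
  moreover have "((\<lambda>i. (\<integral>x. f x \<partial>R i) - (\<integral>x. h x \<partial>R i)) \<longlongrightarrow> 0) F"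
  proof (rule Lim_null_comparison)
    interpret \<nu>: prob_space \<nu> by fact
    have "((\<lambda>i. \<integral>x. \<phi> x \<partial>R i) \<longlongrightarrow> (\<integral>x. \<phi> x \<partial>\<nu>)) F"
      using conv \<phi>(1) \<phi>_range unfolding simplex_weak_conv_def
      by (auto simp: bounded_iff intro!: exI[of _ 1])
    moreover have "(\<integral>x. \<phi> x \<partial>\<nu>) = (\<integral>x. 1 \<partial>\<nu>)"
      using AE_measure_support[OF \<nu>(2)] int[OF \<nu>]
      by (intro integral_cong_AE) (auto simp: \<phi>(3) elim!: eventually_mono)
    ultimately show "((\<lambda>i. 1 - (\<integral>x. \<phi> x \<partial>R i)) \<longlongrightarrow> 0) F"
      by (auto intro!: tendsto_eq_intros simp: \<nu>.prob_space)
    show "\<forall>\<^sub>F i in F. norm ((\<integral>x. f x \<partial>R i) - (\<integral>x. h x \<partial>R i)) \<le> 1 - (\<integral>x. \<phi> x \<partial>R i)"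
      using R
    proof eventually_elim
      case (elim i)
      then interpret P: prob_space "R i" by simp
      have int: "integrable (R i) f" "integrable (R i) h" "integrable (R i) \<phi>"
        using int elim by simp_all
      have sp: "space (R i) = prob_simplex"
        using elim sets_eq_imp_space_eq[of "R i" simplex_borel] by simp
      have "norm ((\<integral>x. f x \<partial>R i) - (\<integral>x. h x \<partial>R i)) = norm (\<integral>x. f x - h x \<partial>R i)"
        using int by simp
      also have "\<dots> \<le> (\<integral>x. 1 - \<phi> x \<partial>R i)"
      proof (rule Bochner_Integration.integral_norm_bound_integral)
        fix x assume "x \<in> space (R i)"
        then have x: "x \<in> prob_simplex" by (simp add: sp)
        have "\<bar>f x\<bar> * (1 - \<phi> x) \<le> 1 * (1 - \<phi> x)"
          using f(2)[OF x] \<phi>_range[OF x] by (intro mult_right_mono) auto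
        moreover have "f x - h x = f x * (1 - \<phi> x)" by (simp add: h_def algebra_simps)
        ultimately show "norm (f x - h x) \<le> 1 - \<phi> x"
          using \<phi>_range[OF x] by (simp add: abs_mult)
      qed (use int in simp_all)
      also have "\<dots> = 1 - (\<integral>x. \<phi> x \<partial>R i)"
        using int by (simp add: P.prob_space)
      finally show ?case .
    qed
  qed
  ultimately show ?thesis
    using tendsto_add[of "\<lambda>i. (\<integral>x. f x \<partial>R i) - (\<integral>x. h x \<partial>R i)" 0 F "\<lambda>i. \<integral>x. h x \<partial>R i"] by simp
qed

section \<open>Convergence in total variation\<close>

lemma tv_dist_point_le:
  assumes "finite (space P)" "y \<in> space P"
  shows "\<bar>measure P {y} - measure Q {y}\<bar> / 2 \<le> tv_dist P Q"
  using member_le_sum[of y "space P" "\<lambda>y. \<bar>measure P {y} - measure Q {y}\<bar>"] assms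
  by (simp add: tv_dist_def)

text \<open>The half in the integrand is the one in \<open>tv_dist\<close>, of which a single
  summand is kept. The squeeze takes place in the extended nonnegative reals, where \<open>d\<close>
  lives, and is then transferred to the reals; the final factor 2 undoes the half.\<close>

lemma tendsto_integral_close:
  fixes k :: "'i \<Rightarrow> 'b \<Rightarrow> real"
  assumes close: "\<forall>\<^sub>F i in F. integrable (R i) (k i) \<and> integrable (R i) f \<and>
      (\<integral>\<^sup>+x. ennreal (\<bar>k i x - f x\<bar> / 2) \<partial>R i) \<le> d i"
    and d: "(d \<longlongrightarrow> 0) F" and f: "((\<lambda>i. \<integral>x. f x \<partial>R i) \<longlongrightarrow> c) F"
  shows "((\<lambda>i. \<integral>x. k i x \<partial>R i) \<longlongrightarrow> c) F"
proof -
  let ?e = "\<lambda>i. \<bar>((\<integral>x. k i x \<partial>R i) - (\<integral>x. f x \<partial>R i)) / 2\<bar>"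
  have "((\<lambda>i. ennreal (?e i)) \<longlongrightarrow> 0) F"
  proof (rule tendsto_sandwich[OF _ _ tendsto_const d])
    show "\<forall>\<^sub>F i in F. ennreal (?e i) \<le> d i"
      using close
    proof eventually_elim
      case (elim i)
      then have int: "integrable (R i) (\<lambda>x. (k i x - f x) / 2)" by simp
      have "?e i = norm (\<integral>x. (k i x - f x) / 2 \<partial>R i)"
        using elim by simp
      then have "ennreal (?e i) \<le> (\<integral>\<^sup>+x. ennreal (\<bar>k i x - f x\<bar> / 2) \<partial>R i)"
        using integral_norm_bound_ennreal[OF int] by simp
      also have "\<dots> \<le> d i" using elim by blast
      finally show ?case .
    qed
  qed simp
  then have "((\<lambda>i. ?e i) \<longlongrightarrow> 0) F"
    using tendsto_ennreal_iff[of ?e F 0] by simp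
  then have "((\<lambda>i. 2 * (((\<integral>x. k i x \<partial>R i) - (\<integral>x. f x \<partial>R i)) / 2)) \<longlongrightarrow> 2 * 0) F"
    by (intro tendsto_mult tendsto_const) (rule tendsto_rabs_zero_cancel)
  from tendsto_add[OF this f] show ?thesis by (simp add: diff_divide_distrib)
qed

text \<open>The quantity \<open>k\<close> links two sides: it is the point mass inside the averaged
  total variation distance, and its posterior integral will be the point mass of a block under the
  horizon law. Measurability and the bound by 1 make it integrable.\<close>

lemma
  fixes A :: "(real^'a::finite) set"
  defines "k \<equiv> \<lambda>N m y \<mu>. measure (distr (constrained_component A N \<mu>) (seq_space {1..m}) (\<lambda>x. restrict x {1..m})) {y}"
  assumes m: "m \<le> N" and y: "y \<in> space (seq_space {1..m})"
  shows measurable_initial_block: "k N m y \<in> borel_measurable simplex_borel"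
    and initial_block_le_1: "k N m y \<mu> \<le> 1"
    and initial_block_eq: "k N m y \<mu> =
      measure (constrained_component A N \<mu>) {x \<in> space (seq_space {1..N}). restrict x {1..m} = y}"
proof -
  let ?R = "{x \<in> space (seq_space {1..N}). restrict x {1..m} = y}"
  have R: "?R \<in> sets (seq_space {1..N})" by (rule sets_seq_space_finite) auto
  have eq: "k N m y \<mu> = measure (constrained_component A N \<mu>) ?R" for \<mu>
  proof -
    have "(\<lambda>x. restrict x {1..m}) \<in> constrained_component A N \<mu> \<rightarrow>\<^sub>M seq_space {1..m}"
      using measurable_restrict_seq_space[of "{1..m}" "{1..N}"] m
      by (simp cong: measurable_cong_sets add: sets_constrained_component)
    moreover have "{y} \<in> sets (seq_space {1..m})" using y by (intro sets_seq_space_finite) auto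
    ultimately have "k N m y \<mu> = measure (constrained_component A N \<mu>)
        ((\<lambda>x. restrict x {1..m}) -` {y} \<inter> space (constrained_component A N \<mu>))"
      unfolding k_def by (rule measure_distr)
    also have "(\<lambda>x. restrict x {1..m}) -` {y} \<inter> space (constrained_component A N \<mu>) = ?R"
      unfolding space_constrained_component by blast
    finally show ?thesis .
  qed
  then show "k N m y \<mu> = measure (constrained_component A N \<mu>) ?R" .
  show "k N m y \<in> borel_measurable simplex_borel"
    unfolding eq using measurable_compose[OF measurable_constrained_component measurable_measure_subprob_algebra[OF R]] .
  show "k N m y \<mu> \<le> 1"
    unfolding eq by (rule subprob_space.subprob_measure_le_1) (rule subprob_space_constrained_component)
qed

text \<open>Disintegration over the parameter and symmetry within each component replace the block
  by the initial one, so the right-hand side depends on \<open>I\<close> only through its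
  size.\<close>

lemma measure_horizon_block:
  fixes \<rho> :: "(real^'a::finite) measure"
  assumes \<rho>: "prob_space \<rho>" "sets \<rho> = sets simplex_borel" and pos: "0 < event_mass \<rho> A N"
    and I: "I \<subseteq> {1..N}" "card I = m" and y: "y \<in> space (seq_space {1..m})"
  shows "measure (distr (constrained_horizon_law \<rho> A N) (seq_space {1..m}) (\<lambda>w. block I (snd w))) {y} =
      (\<integral>\<mu>. measure (distr (constrained_component A N \<mu>) (seq_space {1..m}) (\<lambda>x. restrict x {1..m})) {y}
        \<partial>constraint_posterior \<rho> A N)"
    (is "measure ?D {y} = (\<integral>\<mu>. ?k \<mu> \<partial>?\<Pi>)")
proof -
  have m: "m \<le> N" using card_mono[OF _ I(1)] I(2) by simp
  have sets_\<Pi>: "sets ?\<Pi> = sets simplex_borel" using \<rho>(2) by (simp add: sets_constraint_posterior)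
  interpret \<Pi>: prob_space ?\<Pi> by (rule prob_space_constraint_posterior[OF \<rho> pos])
  have "block I \<in> seq_space {1..N} \<rightarrow>\<^sub>M seq_space {1..m}"
    using I(2) by (intro measurable_seq_space_finite) (auto simp: space_seq_space block_def)
  then have block: "(\<lambda>w. block I (snd w)) \<in> simplex_borel \<Otimes>\<^sub>M seq_space {1..N} \<rightarrow>\<^sub>M seq_space {1..m}"
    by (rule measurable_compose[OF measurable_snd])
  have y': "{y} \<in> sets (seq_space {1..m})" using y by (intro sets_seq_space_finite) auto
  have "emeasure ?D {y} = (\<integral>\<^sup>+\<mu>. emeasure (constrained_component A N \<mu>)
      {x \<in> space (seq_space {1..N}). block I x = y} \<partial>?\<Pi>)"
    unfolding constrained_horizon_law_def
    using emeasure_distr_joint_law[OF sets_\<Pi> \<Pi>.not_empty measurable_constrained_component block y'] by simp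
  also have "\<dots> = (\<integral>\<^sup>+\<mu>. ennreal (?k \<mu>) \<partial>?\<Pi>)"
    unfolding emeasure_constrained_component_block[OF I] initial_block_eq[OF m y]
    by (intro nn_integral_cong finite_measure.emeasure_eq_measure subprob_space.axioms(1)
        subprob_space_constrained_component)
  also have "\<dots> = ennreal (\<integral>\<mu>. ?k \<mu> \<partial>?\<Pi>)"
  proof (intro nn_integral_eq_integral AE_I2 measure_nonneg \<Pi>.integrable_const_bound[where B=1])
    show "?k \<in> borel_measurable ?\<Pi>"
      using measurable_initial_block[OF m y] by (simp cong: measurable_cong_sets add: sets_\<Pi>)
    show "norm (?k \<mu>) \<le> 1" for \<mu>
      using initial_block_le_1[OF m y] by simp
  qed
  finally show ?thesis
    by (simp add: measure_def integral_nonneg_AE)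
qed

text \<open>The filter \<open>F\<close> lets \<open>N\<close> tend to infinity within the horizons
  \<open>\<N>\<close>. A directing measure presupposes a probability space that carries both
  parameter and sequence; \<open>J\<close> is the canonical one, on pairs
  \<open>(\<mu>, x)\<close>.\<close>

theorem theorem4:
  fixes g :: "nat \<Rightarrow> 'a::finite \<Rightarrow> real" and \<alpha> :: "nat \<Rightarrow> real" and r0 r :: nat
    and \<epsilon> :: "nat \<Rightarrow> real" and \<N> :: "nat set"
    and \<rho> \<rho>E :: "(real^'a) measure"
  defines "E \<equiv> constraint_set g \<alpha> r0 r"
    and "A \<equiv> (\<lambda>N. relaxed_constraint_set g \<alpha> r0 r (\<epsilon> N))"
    and "F \<equiv> inf sequentially (principal \<N>)"
  assumes "r0 \<le> r"
    and "E \<noteq> {}"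
    and horizons: "infinite \<N>" "\<N> \<subseteq> {1..}"
    and eps: "\<forall>N\<in>\<N>. \<epsilon> N > 0" "(\<epsilon> \<longlongrightarrow> 0) F"
    and prior: "prob_space \<rho>" "sets \<rho> = sets simplex_borel"
    and mass: "\<forall>N\<in>\<N>. event_mass \<rho> (A N) N > 0"
    and T_defined: "\<forall>N\<in>\<N>. AE \<mu> in constraint_posterior \<rho> (A N) N. \<mu> \<in> proj_dom E"
    and limit: "prob_space \<rho>E" "sets \<rho>E = sets simplex_borel"
    and i: "simplex_weak_conv (\<lambda>N. constraint_posterior \<rho> (A N) N) \<rho>E F"
    and ii: "\<exists>U. openin (top_of_set prob_simplex) U \<and> measure_support \<rho>E \<subseteq> U \<and>
                 U \<subseteq> proj_dom E \<and> continuous_on U (proj_map E)"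
    and iii: "\<forall>m\<ge>1. ((\<lambda>N. \<integral>\<^sup>+\<mu>. ennreal (tv_dist
                  (distr (constrained_component (A N) N \<mu>) (seq_space {1..m}) (\<lambda>x. restrict x {1..m}))
                  (iid_law {1..m} (proj_map E \<mu>))) \<partial>constraint_posterior \<rho> (A N) N) \<longlongrightarrow> 0) F"
  defines "\<rho>T \<equiv> distr \<rho>E simplex_borel (proj_map E)"
    and "J \<equiv> joint_law {1..} \<rho>E (\<lambda>\<mu>. iid_law {1..} (proj_map E \<mu>))"
  shows
    "(\<forall>m\<ge>1. \<forall>I :: nat \<Rightarrow> nat set. (\<forall>N\<in>\<N>. m \<le> N \<longrightarrow> I N \<subseteq> {1..N} \<and> card (I N) = m) \<longrightarrow>
       ((\<lambda>N. tv_dist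
           (distr (constrained_horizon_law \<rho> (A N) N) (seq_space {1..m}) (\<lambda>w. block (I N) (snd w)))
           (\<rho>E \<bind> (\<lambda>\<mu>. iid_law {1..m} (proj_map E \<mu>)))) \<longlongrightarrow> 0) F) \<and>
     projectively_consistent (\<lambda>m. iid_mixture {1..m} \<rho>T) \<and>
     sequence_law_with_marginals (\<lambda>m. iid_mixture {1..m} \<rho>T) (iid_mixture {1..} \<rho>T) \<and>
     (\<forall>L. sequence_law_with_marginals (\<lambda>m. iid_mixture {1..m} \<rho>T) L \<longrightarrow> L = iid_mixture {1..} \<rho>T) \<and>
     exchangeable_law (iid_mixture {1..} \<rho>T) \<and>
     prob_space J \<and>
     distr J simplex_borel fst = \<rho>E \<and>
     distr J (seq_space {1..}) snd = iid_mixture {1..} \<rho>T \<and>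
     distr J simplex_borel (\<lambda>w. proj_map E (fst w)) = \<rho>T \<and>
     directs J (\<lambda>w. proj_map E (fst w)) snd"
proof -
  let ?T = "proj_map E"
  let ?\<Pi> = "\<lambda>N. constraint_posterior \<rho> (A N) N"
  have E_def': "E = constraint_set g \<alpha> r0 r" by (simp only: E_def)
  note ne = \<open>E \<noteq> {}\<close>
  have T: "?T \<in> simplex_borel \<rightarrow>\<^sub>M simplex_borel" by (rule measurable_proj_map[OF E_def' ne])
  have T_simplex: "?T \<mu> \<in> prob_simplex" if "\<mu> \<in> prob_simplex" for \<mu>
    using measurable_space[OF T] that by simp
  interpret \<rho>E: prob_space \<rho>E by (rule limit)
  have T\<rho>: "?T \<in> \<rho>E \<rightarrow>\<^sub>M simplex_borel" using T by (simp cong: measurable_cong_sets add: limit(2))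
  have \<rho>T: "prob_space \<rho>T" "sets \<rho>T = sets simplex_borel"
    unfolding \<rho>T_def by (simp_all add: \<rho>E.prob_space_distr[OF T\<rho>])
  have \<Pi>: "prob_space (?\<Pi> N) \<and> sets (?\<Pi> N) = sets simplex_borel" if "N \<in> \<N>" for N
    using prob_space_constraint_posterior[OF prior] mass that
    by (simp add: sets_constraint_posterior prior(2))
  obtain U where U: "openin (top_of_set prob_simplex) U" "measure_support \<rho>E \<subseteq> U" "continuous_on U ?T"
    using ii by blast

  \<comment> \<open>Total variation convergence of blocks\<close>
  have tv: "((\<lambda>N. tv_dist
           (distr (constrained_horizon_law \<rho> (A N) N) (seq_space {1..m}) (\<lambda>w. block (I N) (snd w)))
           (\<rho>E \<bind> (\<lambda>\<mu>. iid_law {1..m} (?T \<mu>)))) \<longlongrightarrow> 0) F"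
    if m: "1 \<le> m" and I: "\<forall>N\<in>\<N>. m \<le> N \<longrightarrow> I N \<subseteq> {1..N} \<and> card (I N) = m" for m I
  proof -
    let ?S = "seq_space {1..m} :: (nat \<Rightarrow> 'a) measure"
    let ?D = "\<lambda>N. distr (constrained_horizon_law \<rho> (A N) N) ?S (\<lambda>w. block (I N) (snd w))"
    let ?L = "\<rho>E \<bind> (\<lambda>\<mu>. iid_law {1..m} (?T \<mu>))"
    \<comment> \<open>A block of \<open>m\<close> distinct coordinates exists only for
      \<open>N \<ge> m\<close>, and positivity of the normalizer is known on \<open>\<N>\<close>;
      both conditions hold eventually along \<open>F\<close>.\<close>
    have large: "\<forall>\<^sub>F N in F. N \<in> \<N> \<and> m \<le> N"
      unfolding F_def eventually_inf_principal by (rule eventually_mono[OF eventually_ge_at_top]) auto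
    \<comment> \<open>The block space is finite, so convergence of each point mass suffices.\<close>
    have point: "((\<lambda>N. measure (?D N) {y}) \<longlongrightarrow> measure ?L {y}) F" if y: "y \<in> space ?S" for y
    proof -
      define f where "f = (\<lambda>\<mu>. measure (iid_law {1..m} (?T \<mu>)) {y})"
      define k where "k = (\<lambda>N \<mu>. measure (distr (constrained_component (A N) N \<mu>) ?S (\<lambda>x. restrict x {1..m})) {y})"
      have y': "{y} \<in> sets ?S" using y by (intro sets_seq_space_finite) auto
      have iid: "(\<lambda>\<mu>. iid_law {1..m} (?T \<mu>)) \<in> simplex_borel \<rightarrow>\<^sub>M prob_algebra ?S"
        by (rule measurable_compose[OF T measurable_iid_law])
      have f_meas: "f \<in> borel_measurable simplex_borel"
        unfolding f_def by (rule measurable_compose[OF iid measurable_measure_prob_algebra[OF y']])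
      have f_range: "0 \<le> f \<mu>" "f \<mu> \<le> 1" for \<mu>
        by (auto simp: f_def intro!: prob_space.prob_le_1 prob_space_iid_law)
      \<comment> \<open>On \<open>U\<close> the point mass is a product of coordinates of the
        projection and inherits its continuity.\<close>
      have "continuous_on U (\<lambda>\<mu>. \<Prod>j\<in>{1..m}. ?T \<mu> $ y j)"
        by (intro continuous_on_prod continuous_on_component U(3))
      moreover have "f \<mu> = (\<Prod>j\<in>{1..m}. ?T \<mu> $ y j)" if "\<mu> \<in> U" for \<mu>
        using T_simplex openin_imp_subset[OF U(1)] that
        unfolding f_def by (intro measure_iid_law_point y) auto
      ultimately have f_cont: "continuous_on U f" using continuous_on_cong[OF refl] by simp
      have f_int: "integrable P f" if "prob_space P \<and> sets P = sets simplex_borel" for P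
      proof -
        interpret prob_space P using that by simp
        show ?thesis
          using f_meas f_range that
          by (intro integrable_const_bound[where B=1] AE_I2) (simp_all cong: measurable_cong_sets)
      qed
      have "((\<lambda>N. \<integral>\<mu>. f \<mu> \<partial>?\<Pi> N) \<longlongrightarrow> (\<integral>\<mu>. f \<mu> \<partial>\<rho>E)) F"
      proof (rule simplex_weak_conv_locally_continuous[OF i _ limit U(1,2) f_cont f_meas])
        show "\<forall>\<^sub>F N in F. prob_space (?\<Pi> N) \<and> sets (?\<Pi> N) = sets simplex_borel"
          using large by eventually_elim (use \<Pi> in blast)
      qed (use f_range in simp)
      moreover have "\<forall>\<^sub>F N in F. integrable (?\<Pi> N) (k N) \<and> integrable (?\<Pi> N) f \<and>
          (\<integral>\<^sup>+\<mu>. ennreal (\<bar>k N \<mu> - f \<mu>\<bar> / 2) \<partial>?\<Pi> N) \<le>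
          (\<integral>\<^sup>+\<mu>. ennreal (tv_dist (distr (constrained_component (A N) N \<mu>) ?S (\<lambda>x. restrict x {1..m}))
             (iid_law {1..m} (?T \<mu>))) \<partial>?\<Pi> N)"
        using large
      proof eventually_elim
        case (elim N)
        then interpret P: prob_space "?\<Pi> N" using \<Pi> by blast
        have "k N \<in> borel_measurable (?\<Pi> N)"
          unfolding k_def using measurable_initial_block[of m N y "A N"] elim y \<Pi>[of N]
          by (simp cong: measurable_cong_sets)
        moreover have "norm (k N \<mu>) \<le> 1" for \<mu>
          unfolding k_def using initial_block_le_1[of m N y "A N" \<mu>] elim y by simp
        ultimately have "integrable (?\<Pi> N) (k N)"
          by (intro P.integrable_const_bound[where B=1] AE_I2)
        moreover have "(\<integral>\<^sup>+\<mu>. ennreal (\<bar>k N \<mu> - f \<mu>\<bar> / 2) \<partial>?\<Pi> N) \<le>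
          (\<integral>\<^sup>+\<mu>. ennreal (tv_dist (distr (constrained_component (A N) N \<mu>) ?S (\<lambda>x. restrict x {1..m}))
             (iid_law {1..m} (?T \<mu>))) \<partial>?\<Pi> N)"
          unfolding k_def f_def using y
          by (intro nn_integral_mono ennreal_leI tv_dist_point_le) (simp_all add: finite_space_seq_space)
        ultimately show ?case using f_int \<Pi> elim by blast
      qed
      \<comment> \<open>By the third assumption \<open>k N\<close> and \<open>f\<close> have
        asymptotically equal posterior integrals, so the weak limit found for \<open>f\<close> is
        also the limit for \<open>k N\<close>.\<close>
      ultimately have lim: "((\<lambda>N. \<integral>\<mu>. k N \<mu> \<partial>?\<Pi> N) \<longlongrightarrow> (\<integral>\<mu>. f \<mu> \<partial>\<rho>E)) F"
        using iii m by (intro tendsto_integral_close[where R="?\<Pi>" and k=k and f=f]) auto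
      have "(\<lambda>\<mu>. iid_law {1..m} (?T \<mu>)) \<in> \<rho>E \<rightarrow>\<^sub>M subprob_algebra ?S"
        using measurable_prob_algebraD[OF iid] by (simp cong: measurable_cong_sets add: limit(2))
      then have "emeasure ?L {y} = (\<integral>\<^sup>+\<mu>. emeasure (iid_law {1..m} (?T \<mu>)) {y} \<partial>\<rho>E)"
        using y' by (intro emeasure_bind \<rho>E.not_empty)
      also have "\<dots> = (\<integral>\<^sup>+\<mu>. ennreal (f \<mu>) \<partial>\<rho>E)"
        unfolding f_def
        by (intro nn_integral_cong finite_measure.emeasure_eq_measure prob_space.finite_measure prob_space_iid_law)
      also have "\<dots> = ennreal (\<integral>\<mu>. f \<mu> \<partial>\<rho>E)"
        using f_range limit by (intro nn_integral_eq_integral f_int AE_I2) auto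
      finally have "measure ?L {y} = (\<integral>\<mu>. f \<mu> \<partial>\<rho>E)"
        using f_range by (simp add: measure_def integral_nonneg_AE)
      moreover have "\<forall>\<^sub>F N in F. (\<integral>\<mu>. k N \<mu> \<partial>?\<Pi> N) = measure (?D N) {y}"
        using large
      proof eventually_elim
        case (elim N)
        then show ?case
          unfolding k_def using mass I y
          by (intro measure_horizon_block[symmetric] prior) auto
      qed
      ultimately show ?thesis using lim tendsto_cong by force
    qed
    \<comment> \<open>The limit is written in the same form as the distance so that it can be taken
      term by term; each of its summands is 0.\<close>
    have "((\<lambda>N. (1/2) * (\<Sum>y\<in>space ?S. \<bar>measure (?D N) {y} - measure ?L {y}\<bar>)) \<longlongrightarrow>
        (1/2) * (\<Sum>y\<in>space ?S. \<bar>measure ?L {y} - measure ?L {y}\<bar>)) F"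
      by (intro tendsto_mult tendsto_const tendsto_sum tendsto_rabs tendsto_diff point)
    then show ?thesis by (simp add: tv_dist_def)
  qed

  \<comment> \<open>The infinite mixture and its directing measure\<close>
  note joint = prob_space_joint_iid[OF limit T] distr_fst_joint_iid[OF limit T]
    distr_snd_joint_iid[OF limit T] directs_joint_iid[OF limit T]
  have fst_meas: "fst \<in> J \<rightarrow>\<^sub>M simplex_borel"
    unfolding J_def
    using sets_joint_law[OF limit(2) measurable_compose[OF T measurable_prob_algebraD[OF measurable_iid_law]]
        \<rho>E.not_empty, of "{1..}"]
    by (simp cong: measurable_cong_sets)
  have "distr J simplex_borel (?T \<circ> fst) = distr (distr J simplex_borel fst) simplex_borel ?T"
    by (rule distr_distr[OF T fst_meas, symmetric])
  then have "distr J simplex_borel (\<lambda>w. ?T (fst w)) = \<rho>T"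
    using joint(2) by (simp add: J_def \<rho>T_def comp_def)
  moreover have "L = iid_mixture {1..} \<rho>T"
    if "sequence_law_with_marginals (\<lambda>m. iid_mixture {1..m} \<rho>T) L" for L
    using sequence_law_with_marginals_unique[OF that sequence_law_with_marginals_iid_mixture[OF \<rho>T]] .
  ultimately show ?thesis
    using tv joint projectively_consistent_iid_mixture[OF \<rho>T]
      sequence_law_with_marginals_iid_mixture[OF \<rho>T] exchangeable_law_iid_mixture[OF \<rho>T]
    unfolding J_def \<rho>T_def by blast
qed

end
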